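(* Let $p_1,\dots,p_m$ be independent $p$-values with set of true nulls $\mathcal H_0\subset\{1,\dots,m\}$, such that $p_i\sim U(0,1)$ for $i\in\mathcal H_0$. Let $\delta\in(0,1)$, $V_t=\sum_{i=1}^m\mathbf 1\{p_i>t\}$, $C=\log(1/\delta)/2$, $C'=\frac{\log(1/\delta)}{\log(1+\log(1/\delta))}$, $\kappa=\pi^2/6$, $C_t=2\log(\kappa/\delta)+4\log(1+\log_2(1/t))$, and $$\hat m_0^{\mathrm{Simes}}=m\wedge\inf_{t\in(0,\delta)}\frac{V_t}{1-t/\delta},\qquad \hat m_0^{\mathrm{DKW}}=m\wedge\inf_{t\in(0,1)}\left(\frac{C^{1/2}}{2(1-t)}+\sqrt{\frac{C}{4(1-t)^2}+\frac{V_t}{1-t}}\right)^2,$$ $$\hat m_0^{\mathrm{KR}}=m\wedge\inf_{t\in(0,1/C')}\frac{C'+V_t}{1-C't},\qquad \hat m_0^{\mathrm{Well}}=m\wedge\inf_{t\in(0,1)}\left(\sqrt{\frac{tC_t}{2(1-t)^2}}+\sqrt{\frac{C_t}{2(1-t)^2}+\frac{V_t}{1-t}}\right)^2.$$ Then each of the following four sequences $(\overline{\mathrm{FDP}}_k)_{1\le k\le m}$ (the third one under the additional requirement $\delta\le0.31$) satisfies $\mathbf P(\forall k\in\{1,\dots,m\},\ \mathrm{FDP}(R_k)\le\overline{\mathrm{FDP}}_k)\ge1-\delta$, where $R_k=\{i:p_i\le p_{(k)}\}$: $$1\wedge\frac{\hat m_0^{\mathrm{Simes}}p_{(k)}}{k\delta};\qquad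 1\wedge\left(\frac{\hat m_0^{\mathrm{DKW}}p_{(k)}}{k}+\frac{(\hat m_0^{\mathrm{DKW}})^{1/2}\sqrt{0.5\log(1/\delta)}}{k}\right);$$ $$1\wedge\left(\frac{\log(1/\delta)}{\log(1+\log(1/\delta))}\Bigl(\frac{\hat m_0^{\mathrm{KR}}p_{(k)}}{k}+\frac1k\Bigr)\right);\qquad 1\wedge\left(\frac{\hat m_0^{\mathrm{Well}}p_{(k)}}{k}\,h^{-1}\!\left(\frac{2\log(\kappa/\delta)+4\log(1+\log_2(1/p_{(k)}))}{\hat m_0^{\mathrm{Well}}p_{(k)}}\right)\right).$$
   Context: Top-$k$ setting: $p_1,\dots,p_m\in[0,1]$ are independent, $\mathcal H_0$ is a fixed subset of $\{1,\dots,m\}$ of cardinality $m_0$, $0<m_0<m$; nothing is assumed on the marginals of $p_i$, $i\notin\mathcal H_0$. $p_{(1)}\le\dots\le p_{(m)}$ are the ordered $p$-values. $\mathrm{FDP}(R)=|R\cap\mathcal H_0|/(|R|\vee1)$. The function $h(\lambda)=\lambda(\log\lambda-1)+1$, $\lambda>1$, is an increasing bijection from $(1,\infty)$ onto $(0,\infty)$ with inverse $h^{-1}$. If $p_{(k)}=0$, the last expression is read as its limit $0$. *)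

theory Defs
  imports "HOL-Probability.Probability"
begin

text \<open>
  Throughout, a realization of the p-values is a function \<open>q :: nat \<Rightarrow> real\<close>, of which only the
  values at the indices \<open>1, \<dots>, m\<close> matter.
\<close>

definition ordered_pvalue :: "nat \<Rightarrow> (nat \<Rightarrow> real) \<Rightarrow> nat \<Rightarrow> real" where
  "ordered_pvalue m q k = sort (map q [1..<Suc m]) ! (k - 1)"

definition rejection_set :: "nat \<Rightarrow> (nat \<Rightarrow> real) \<Rightarrow> nat \<Rightarrow> nat set" where
  "rejection_set m q k = {i \<in> {1..m}. q i \<le> ordered_pvalue m q k}"

definition FDP :: "nat set \<Rightarrow> nat set \<Rightarrow> real" where
  "FDP H0 R = real (card (R \<inter> H0)) / real (max (card R) 1)"

definition num_above :: "nat \<Rightarrow> (nat \<Rightarrow> real) \<Rightarrow> real \<Rightarrow> nat" where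
  "num_above m q t = card {i \<in> {1..m}. q i > t}"

definition C_DKW :: "real \<Rightarrow> real" where
  "C_DKW \<delta> = ln (1 / \<delta>) / 2"

definition C_KR :: "real \<Rightarrow> real" where
  "C_KR \<delta> = ln (1 / \<delta>) / ln (1 + ln (1 / \<delta>))"

definition kappa :: real where
  "kappa = pi\<^sup>2 / 6"

definition C_Well :: "real \<Rightarrow> real \<Rightarrow> real" where
  "C_Well \<delta> t = 2 * ln (kappa / \<delta>) + 4 * ln (1 + log 2 (1 / t))"

definition h_fun :: "real \<Rightarrow> real" where
  "h_fun x = x * (ln x - 1) + 1"

text \<open>On \<open>{1<..}\<close> the function \<^const>\<open>h_fun\<close> is injective with range \<open>{0<..}\<close>; the inverse below
  is meaningful only at positive arguments.\<close>

definition h_inv :: "real \<Rightarrow> real" where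
  "h_inv = the_inv_into {1<..} h_fun"

definition m0_Simes :: "nat \<Rightarrow> real \<Rightarrow> (nat \<Rightarrow> real) \<Rightarrow> real" where
  "m0_Simes m \<delta> q =
     min (real m) (INF t\<in>{0<..<\<delta>}. real (num_above m q t) / (1 - t / \<delta>))"

definition m0_DKW :: "nat \<Rightarrow> real \<Rightarrow> (nat \<Rightarrow> real) \<Rightarrow> real" where
  "m0_DKW m \<delta> q =
     min (real m) (INF t\<in>{0<..<1}.
       (sqrt (C_DKW \<delta>) / (2 * (1 - t))
        + sqrt (C_DKW \<delta> / (4 * (1 - t)\<^sup>2) + real (num_above m q t) / (1 - t)))\<^sup>2)"

definition m0_KR :: "nat \<Rightarrow> real \<Rightarrow> (nat \<Rightarrow> real) \<Rightarrow> real" where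
  "m0_KR m \<delta> q =
     min (real m) (INF t\<in>{0<..<1 / C_KR \<delta>}.
       (C_KR \<delta> + real (num_above m q t)) / (1 - C_KR \<delta> * t))"

definition m0_Well :: "nat \<Rightarrow> real \<Rightarrow> (nat \<Rightarrow> real) \<Rightarrow> real" where
  "m0_Well m \<delta> q =
     min (real m) (INF t\<in>{0<..<1}.
       (sqrt (t * C_Well \<delta> t / (2 * (1 - t)\<^sup>2))
        + sqrt (C_Well \<delta> t / (2 * (1 - t)\<^sup>2) + real (num_above m q t) / (1 - t)))\<^sup>2)"

definition FDP_bound_Simes :: "nat \<Rightarrow> real \<Rightarrow> (nat \<Rightarrow> real) \<Rightarrow> nat \<Rightarrow> real" where
  "FDP_bound_Simes m \<delta> q k =
     min 1 (m0_Simes m \<delta> q * ordered_pvalue m q k / (real k * \<delta>))"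

definition FDP_bound_DKW :: "nat \<Rightarrow> real \<Rightarrow> (nat \<Rightarrow> real) \<Rightarrow> nat \<Rightarrow> real" where
  "FDP_bound_DKW m \<delta> q k =
     min 1 (m0_DKW m \<delta> q * ordered_pvalue m q k / real k
            + sqrt (m0_DKW m \<delta> q) * sqrt (1 / 2 * ln (1 / \<delta>)) / real k)"

definition FDP_bound_KR :: "nat \<Rightarrow> real \<Rightarrow> (nat \<Rightarrow> real) \<Rightarrow> nat \<Rightarrow> real" where
  "FDP_bound_KR m \<delta> q k =
     min 1 (ln (1 / \<delta>) / ln (1 + ln (1 / \<delta>))
            * (m0_KR m \<delta> q * ordered_pvalue m q k / real k + 1 / real k))"

text \<open>At \<open>p\<^sub>(\<^sub>k\<^sub>) = 0\<close> the expression inside the minimum is read as its limit, which is \<open>0\<close>.\<close>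

definition FDP_bound_Well :: "nat \<Rightarrow> real \<Rightarrow> (nat \<Rightarrow> real) \<Rightarrow> nat \<Rightarrow> real" where
  "FDP_bound_Well m \<delta> q k =
     min 1 (if ordered_pvalue m q k = 0 then 0
            else m0_Well m \<delta> q * ordered_pvalue m q k / real k
                 * h_inv ((2 * ln (kappa / \<delta>) + 4 * ln (1 + log 2 (1 / ordered_pvalue m q k)))
                          / (m0_Well m \<delta> q * ordered_pvalue m q k)))"

end

theory Submission
  imports Defs "HOL-Real_Asymp.Real_Asymp"
begin

text \<open>
  Let \<open>N t\<close> count the true nulls with p-value at most \<open>t\<close>, and let \<open>n\<close> be the number of true nulls. As \<open>t\<close>
  decreases, \<open>N t / t\<close> and \<open>(1 + a / t) ^ N t\<close>, for every \<open>a > 0\<close>, are martingales, and a Ville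
  inequality for them bounds the probability that \<open>N\<close> ever exceeds a given curve. The ratio \<open>N t / t\<close>
  gives Simes' inequality. The exponential family gives the other three: an optimal choice of \<open>a\<close>
  reduces the one-sided DKW inequality with Massart's constant, without restriction on the level, to
  Pinsker's inequality for Bernoulli variables; the curve \<open>C' * (1 + n * t)\<close> is treated by the \<open>a\<close> that is
  optimal for a Poisson process; and Wellner's inequality on \<open>[s, 1]\<close> is summed over dyadic \<open>s\<close>.

  Off the exceptional event, \<open>n \<le> N t + V t\<close> for all \<open>t\<close> shows that the estimator of the number of
  nulls is at least \<open>n\<close>, and the bound on \<open>N\<close> at the \<open>k\<close>-th smallest p-value is the claim.
\<close>

section \<open>A Ville inequality for uniform samples\<close>

text \<open>The exceptional events are phrased through the inverse of the curve: for some
  \<open>k >= 1\<close> the \<open>k\<close>-th smallest point is at most \<open>b k\<close>. In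
  this form no continuous-time martingale has to be constructed. Given the largest point, the others
  are uniform below it, so removing it gives an induction on the number of points, and the identity
  \<open>g (Suc k)' = Suc k * g k\<close> makes the resulting integrals telescope. What remains is
  to find, for each curve, one parameter \<open>a\<close> that works for all \<open>t\<close> at
  once. Along an affine curve the logarithm of the martingale is, up to constants, a multiple of
  \<open>(t + e) * ln (1 + a / t)\<close>, which must be bounded below uniformly in
  \<open>t\<close>. It is convex in a suitable variable, so \<open>a\<close> is chosen to put its
  minimum at a point where the value can be computed. The Wellner curve is not affine and is pieced
  together from linear ones, each used on one dyadic block.\<close>

abbreviation (input) unif01 :: "real measure" where
  "unif01 \<equiv> uniform_measure lborel {0..1}"

lemma prob_space_unif01: "prob_space unif01"
  by (rule prob_space_uniform_measure) auto

interpretation unif01: product_sigma_finite "\<lambda>_::nat. unif01"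
  by (intro product_sigma_finite.intro prob_space_imp_sigma_finite prob_space_unif01)

lemma emeasure_unif01_atLeastAtMost:
  assumes "0 \<le> u" "u \<le> 1"
  shows "emeasure unif01 {0..u} = ennreal u"
proof -
  have "{0..1} \<inter> {0..u} = {0..u}" using assms by auto
  then show ?thesis using assms by (simp add: emeasure_uniform_measure divide_ennreal_def)
qed

lemma emeasure_unif01_box:
  fixes I :: "nat set"
  assumes "finite I" "0 \<le> u" "u \<le> 1"
  shows "emeasure (PiM I (\<lambda>_. unif01)) (PiE I (\<lambda>_. {0..u})) = ennreal (u ^ card I)"
proof -
  have "emeasure (PiM I (\<lambda>_. unif01)) (PiE I (\<lambda>_. {0..u})) = (\<Prod>i\<in>I. emeasure unif01 {0..u})"
    by (rule unif01.emeasure_PiM) (use assms in auto)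
  also have "\<dots> = ennreal (u ^ card I)"
    unfolding emeasure_unif01_atLeastAtMost[OF assms(2,3)] using assms by (simp add: ennreal_power)
  finally show ?thesis .
qed

section \<open>Crossing events, expressed by the positions of the points\<close>

definition low_set :: "nat set \<Rightarrow> (nat \<Rightarrow> real) \<Rightarrow> (nat \<Rightarrow> real) \<Rightarrow> bool" where
  "low_set I b x \<longleftrightarrow> (\<exists>J\<subseteq>I. J \<noteq> {} \<and> (\<forall>i\<in>J. x i \<le> b (card J)))"

text \<open>Exchange argument. A witness \<open>J\<close> containing \<open>j\<close> cannot be all
  of \<open>I\<close>, since \<open>x j\<close> is above \<open>b (card I)\<close>. Swapping
  \<open>j\<close> for an index outside \<open>J\<close> keeps the cardinality, hence the level, and
  does not increase the values.\<close>

lemma low_set_remove_max: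
  assumes "finite I" "j \<in> I" and low: "low_set I b x"
    and max: "\<And>i. i \<in> I \<Longrightarrow> x i \<le> x j" and notall: "b (card I) < x j"
  shows "low_set (I - {j}) b x"
proof -
  obtain J where J: "J \<subseteq> I" "J \<noteq> {}" "\<forall>i\<in>J. x i \<le> b (card J)"
    using low unfolding low_set_def by blast
  show ?thesis
  proof (cases "j \<in> J")
    case False
    then show ?thesis using J unfolding low_set_def by blast
  next
    case True
    then have "J \<noteq> I" using J notall by force
    then obtain j' where j': "j' \<in> I" "j' \<notin> J" using J by blast
    define J' where "J' = insert j' (J - {j})"
    have fin: "finite J" using J assms(1) finite_subset by blast
    then have "card J' = card J"
      using True j' card_Suc_Diff1[of J j] by (simp add: J'_def)
    moreover have "x j' \<le> b (card J)" using max[OF j'(1)] True J by force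
    ultimately have "\<forall>i\<in>J'. x i \<le> b (card J')" using J by (auto simp: J'_def)
    moreover have "J' \<subseteq> I - {j}" "J' \<noteq> {}" using J j' True by (auto simp: J'_def)
    ultimately show ?thesis unfolding low_set_def by blast
  qed
qed

lemma low_set_cong: "(\<And>i. i \<in> I \<Longrightarrow> x i = y i) \<Longrightarrow> low_set I b x = low_set I b y"
  unfolding low_set_def by (metis subsetD)

lemma pred_low_set:
  assumes "finite I" "\<And>i. i \<in> I \<Longrightarrow> (\<lambda>\<omega>. X \<omega> i) \<in> borel_measurable M"
  shows "Measurable.pred M (\<lambda>\<omega>. low_set I b (X \<omega>))"
proof -
  have eq: "low_set I b x = (\<exists>J\<in>Pow I. J \<noteq> {} \<and> (\<forall>i\<in>J. x i \<le> b (card J)))" for x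
    unfolding low_set_def by blast
  have [measurable]: "Measurable.pred M (\<lambda>\<omega>. \<forall>i\<in>J. X \<omega> i \<le> b (card J))" if J: "J \<in> Pow I" for J
  proof (rule pred_intros_finite(3))
    show "finite J" using J assms(1) finite_subset by blast
    fix i assume "i \<in> J"
    then have [measurable]: "(\<lambda>\<omega>. X \<omega> i) \<in> borel_measurable M" using J assms(2) by blast
    show "Measurable.pred M (\<lambda>\<omega>. X \<omega> i \<le> b (card J))" by measurable
  qed
  have "Measurable.pred M (\<lambda>\<omega>. \<exists>J\<in>Pow I. J \<noteq> {} \<and> (\<forall>i\<in>J. X \<omega> i \<le> b (card J)))"
    by (rule pred_intros_finite(4)) (use assms in auto)
  then show ?thesis unfolding eq .
qed

text \<open>The measure of this set is deliberately not normalised: for \<open>0 < u <= 1\<close>,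
  dividing by \<open>u ^ card I\<close> would give the conditional probability given that all points
  lie in \<open>{0..u}\<close>. In the induction \<open>u\<close> becomes the position of the point
  removed last.\<close>

definition low_region :: "nat set \<Rightarrow> (nat \<Rightarrow> real) \<Rightarrow> real \<Rightarrow> (nat \<Rightarrow> real) set" where
  "low_region I b u = {x \<in> PiE I (\<lambda>_. {0..u}). low_set I b x}"

text \<open>Measurability is joint in the points and in \<open>u\<close>, because \<open>u\<close>
  will be instantiated by a further random coordinate, the largest point.\<close>

lemma pred_low_region:
  assumes "finite I"
  shows "Measurable.pred (PiM I (\<lambda>_. unif01) \<Otimes>\<^sub>M borel) (\<lambda>(x, u). (\<forall>i\<in>I. 0 \<le> x i \<and> x i \<le> u) \<and> low_set I b x)"
proof -
  have [measurable]: "(\<lambda>z. fst z i) \<in> borel_measurable (PiM I (\<lambda>_. unif01) \<Otimes>\<^sub>M borel)" if "i \<in> I" for i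
  proof -
    have "(\<lambda>z. fst z i) \<in> (PiM I (\<lambda>_. unif01) \<Otimes>\<^sub>M borel) \<rightarrow>\<^sub>M unif01" using that by measurable
    then show ?thesis by (simp cong: measurable_cong_sets)
  qed
  have "Measurable.pred (PiM I (\<lambda>_. unif01) \<Otimes>\<^sub>M borel) (\<lambda>z. low_set I b (fst z))"
    by (rule pred_low_set) (use assms in auto)
  moreover have "Measurable.pred (PiM I (\<lambda>_. unif01) \<Otimes>\<^sub>M borel) (\<lambda>z. \<forall>i\<in>I. 0 \<le> fst z i \<and> fst z i \<le> snd z)"
    by (rule pred_intros_finite(3)[OF assms]) measurable
  ultimately have "Measurable.pred (PiM I (\<lambda>_. unif01) \<Otimes>\<^sub>M borel)
    (\<lambda>z. (\<forall>i\<in>I. 0 \<le> fst z i \<and> fst z i \<le> snd z) \<and> low_set I b (fst z))"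
    by measurable
  then show ?thesis by (simp add: case_prod_beta)
qed

lemma sets_low_region:
  assumes "finite I"
  shows "low_region I b u \<in> sets (PiM I (\<lambda>_. unif01))"
proof -
  let ?P = "PiM I (\<lambda>_. unif01)"
  have "(\<lambda>x. (x, u)) \<in> ?P \<rightarrow>\<^sub>M ?P \<Otimes>\<^sub>M borel" by simp
  from measurable_compose[OF this pred_low_region[OF assms, of b]]
  have "Measurable.pred ?P (\<lambda>x. (\<forall>i\<in>I. 0 \<le> x i \<and> x i \<le> u) \<and> low_set I b x)" by simp
  then have "{x \<in> space ?P. (\<forall>i\<in>I. 0 \<le> x i \<and> x i \<le> u) \<and> low_set I b x} \<in> sets ?P"
    unfolding pred_def .
  moreover have "{x \<in> space ?P. (\<forall>i\<in>I. 0 \<le> x i \<and> x i \<le> u) \<and> low_set I b x} = low_region I b u"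
    by (auto simp: low_region_def space_PiM PiE_iff)
  ultimately show ?thesis by simp
qed

lemma nn_integral_unif01_interval:
  assumes "f \<in> borel_measurable borel" "0 \<le> c" "u \<le> 1"
  shows "(\<integral>\<^sup>+y. f y * indicator {c..u} y \<partial>unif01) = (\<integral>\<^sup>+y. f y * indicator {c..u} y \<partial>lborel)"
proof -
  have [measurable]: "f \<in> borel_measurable borel" by fact
  have "(\<integral>\<^sup>+y. f y * indicator {c..u} y \<partial>unif01) =
      (\<integral>\<^sup>+y. f y * indicator {c..u} y * indicator {0..1} y \<partial>lborel) / emeasure lborel {0..1::real}"
    by (subst nn_integral_uniform_measure) auto
  also have "\<dots> = (\<integral>\<^sup>+y. f y * indicator {c..u} y * indicator {0..1} y \<partial>lborel)"
    by (simp add: divide_ennreal_def)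
  also have "\<dots> = (\<integral>\<^sup>+y. f y * indicator {c..u} y \<partial>lborel)"
    using assms by (intro nn_integral_cong) (auto simp: indicator_def)
  finally show ?thesis .
qed

text \<open>A Ville inequality for the reverse martingales \<open>g (N t) t / t ^ N t\<close>, where \<open>N t\<close> counts the
  points below \<open>t\<close>: the induction step removes the largest point.\<close>

lemma emeasure_low_region:
  fixes g :: "nat \<Rightarrow> real \<Rightarrow> real" and b :: "nat \<Rightarrow> real"
  assumes "finite I" "0 \<le> u" "u \<le> 1" and K: "0 < K"
    and deriv: "\<And>k t. 0 \<le> t \<Longrightarrow> t \<le> 1 \<Longrightarrow> (g (Suc k) has_real_derivative real (Suc k) * g k t) (at t)"
    and meas: "\<And>k. g k \<in> borel_measurable borel"
    and nonneg: "\<And>k t. 0 \<le> t \<Longrightarrow> t \<le> 1 \<Longrightarrow> 0 \<le> g k t"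
    and cross: "\<And>k t. 1 \<le> k \<Longrightarrow> k \<le> card I \<Longrightarrow> 0 \<le> t \<Longrightarrow> t \<le> b k \<Longrightarrow> t \<le> 1 \<Longrightarrow> K * t ^ k \<le> g k t"
  shows "emeasure (PiM I (\<lambda>_. unif01)) (low_region I b u) \<le> ennreal (g (card I) u / K)"
  using assms(1-3) cross
proof (induction "card I" arbitrary: I u)
  case 0
  then have "low_region I b u = {}" by (auto simp: low_region_def low_set_def)
  then show ?case by simp
next
  case (Suc n)
  let ?P = "\<lambda>I. PiM I (\<lambda>_::nat. unif01)"
  note fin[simp] = Suc.prems(1)
  have sub_box: "low_region I b u \<subseteq> PiE I (\<lambda>_. {0..u})" by (auto simp: low_region_def)
  have box_sets: "PiE I (\<lambda>_. {0..c}) \<in> sets (?P I)" for c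
    by (rule sets_PiM_I_finite) auto
  show ?case
  proof (cases "u \<le> b (Suc n)")
    case True
    \<comment> \<open>With \<open>u\<close> below the top level, every configuration in the box has
      crossed, so the volume of the box is bounded by the crossing hypothesis for
      \<open>k = card I\<close>.\<close>
    have "emeasure (?P I) (low_region I b u) \<le> ennreal (u ^ card I)"
      using emeasure_mono[OF sub_box box_sets] emeasure_unif01_box[OF fin Suc.prems(2,3)] by simp
    also have "\<dots> \<le> ennreal (g (card I) u / K)"
    proof (rule ennreal_leI)
      have "K * u ^ card I \<le> g (card I) u"
        using Suc.prems Suc.hyps True by auto
      then show "u ^ card I \<le> g (card I) u / K" using K by (simp add: field_simps)
    qed
    finally show ?thesis .
  next
    case False
    \<comment> \<open>If the largest point is at most \<open>c\<close>, the whole box is charged; if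
      it exceeds \<open>c\<close>, it lies above the top level and can be removed. The cut at 0
      matters because levels may be negative.\<close>
    define c where "c = max 0 (b (Suc n))"
    have c: "0 \<le> c" "c \<le> u" "c \<le> 1" using False Suc.prems by (auto simp: c_def)
    \<comment> \<open>The event that \<open>j\<close> carries the largest point, at a height between
      \<open>c\<close> and \<open>u\<close>. Different \<open>j\<close> overlap only in ties, so the
      union bound over \<open>j\<close> loses nothing.\<close>
    define E where "E j = {x \<in> space (?P I). c \<le> x j \<and> x j \<le> u \<and> (\<forall>i\<in>I-{j}. 0 \<le> x i \<and> x i \<le> x j)
        \<and> low_set (I - {j}) b x}" for j
    have cover: "low_region I b u \<subseteq> PiE I (\<lambda>_. {0..c}) \<union> (\<Union>j\<in>I. E j)"
    proof
      fix x assume x: "x \<in> low_region I b u"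
      then have x': "x \<in> PiE I (\<lambda>_. {0..u})" "low_set I b x" by (auto simp: low_region_def)
      have ne: "I \<noteq> {}" using Suc.hyps(2) by auto
      define v where "v = Max (x ` I)"
      have "v \<in> x ` I" unfolding v_def by (rule Max_in) (use ne in auto)
      then obtain j where j: "j \<in> I" "v = x j" by auto
      have max: "x i \<le> x j" if "i \<in> I" for i
        using j(2) that unfolding v_def by (metis Max_ge finite_imageI fin image_eqI)
      show "x \<in> PiE I (\<lambda>_. {0..c}) \<union> (\<Union>j\<in>I. E j)"
      proof (cases "x j \<le> c")
        case True
        then have "x \<in> PiE I (\<lambda>_. {0..c})" using x' max by (force simp: PiE_iff)
        then show ?thesis by simp
      next
        case False
        have "low_set (I - {j}) b x"
          by (rule low_set_remove_max[OF fin j(1) x'(2)])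
            (use max False Suc.hyps(2) in \<open>auto simp: c_def\<close>)
        then have "x \<in> E j" using x' max False j(1) unfolding E_def
          by (auto simp: PiE_iff space_PiM)
        then show ?thesis using j by blast
      qed
    qed
    have E: "E j \<in> sets (?P I) \<and> emeasure (?P I) (E j) \<le> ennreal ((g (Suc n) u - g (Suc n) c) / (real (Suc n) * K))"
      if j: "j \<in> I" for j
    proof -
      define I' where "I' = I - {j}"
      have I': "finite I'" "j \<notin> I'" "I = insert j I'" "card I' = n"
        using j Suc.hyps(2) by (auto simp: I'_def card_Diff_singleton insert_absorb)
      define G where "G = (\<lambda>(x, u). (\<forall>i\<in>I'. 0 \<le> x i \<and> x i \<le> u) \<and> low_set I' b x :: bool)"
      have G_meas: "Measurable.pred (?P I' \<Otimes>\<^sub>M borel) G"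
        unfolding G_def by (rule pred_low_region[OF I'(1)])
      have map: "(\<lambda>x. (restrict x I', x j)) \<in> ?P I \<rightarrow>\<^sub>M ?P I' \<Otimes>\<^sub>M borel"
      proof (rule measurable_Pair)
        show "(\<lambda>x. restrict x I') \<in> ?P I \<rightarrow>\<^sub>M ?P I'" by (rule measurable_restrict_subset) (use I' in auto)
        have "(\<lambda>x. x j) \<in> ?P I \<rightarrow>\<^sub>M unif01" by (rule measurable_component_singleton) (rule j)
        then show "(\<lambda>x. x j) \<in> ?P I \<rightarrow>\<^sub>M borel" by (simp cong: measurable_cong_sets)
      qed
      have xj: "(\<lambda>x. x j) \<in> borel_measurable (?P I)"
        using measurable_compose[OF map measurable_snd] by simp
      have G_eq: "G (restrict x I', x j) \<longleftrightarrow> (\<forall>i\<in>I'. 0 \<le> x i \<and> x i \<le> x j) \<and> low_set I' b x" for x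
        unfolding G_def using low_set_cong[of I' "restrict x I'" x b] by simp
      have E_eq: "E j = {x \<in> space (?P I). c \<le> x j \<and> x j \<le> u \<and> G (restrict x I', x j)}"
        unfolding E_def I'_def[symmetric] G_eq by (rule refl)
      have "Measurable.pred (?P I) (\<lambda>x. G (restrict x I', x j))"
        using measurable_compose[OF map G_meas] by simp
      then have E_sets: "E j \<in> sets (?P I)"
        unfolding E_eq using xj by measurable
      have "emeasure (?P I) (E j) = (\<integral>\<^sup>+x. indicator (E j) x \<partial>?P (insert j I'))"
        using E_sets I'(3) by simp
      \<comment> \<open>Coordinate \<open>j\<close> is integrated last: for fixed height
        \<open>y\<close> of the largest point the other points range over
        \<open>low_region I' b y\<close>, to which the induction hypothesis applies.\<close>
      also have "\<dots> = (\<integral>\<^sup>+y. (\<integral>\<^sup>+x. indicator (E j) (x(j := y)) \<partial>?P I') \<partial>unif01)"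
        by (rule unif01.product_nn_integral_insert_rev) (use I' E_sets in auto)
      also have "\<dots> = (\<integral>\<^sup>+y. (\<integral>\<^sup>+x. indicator {c..u} y * indicator (low_region I' b y) x \<partial>?P I') \<partial>unif01)"
      proof (intro nn_integral_cong)
        fix y x assume x: "x \<in> space (?P I')"
        have "x(j := y) \<in> E j \<longleftrightarrow> y \<in> {c..u} \<and> x \<in> low_region I' b y"
        proof -
          have "x(j := y) \<in> space (?P I)"
            using x I' by (auto simp: space_PiM PiE_iff extensional_def)
          moreover have "low_set I' b (x(j := y)) = low_set I' b x"
            by (rule low_set_cong) (use I' in auto)
          moreover have "(\<forall>i\<in>I'. 0 \<le> (x(j := y)) i \<and> (x(j := y)) i \<le> y) \<longleftrightarrow> x \<in> PiE I' (\<lambda>_. {0..y})"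
            using x I'(2) by (auto simp: space_PiM PiE_iff)
          ultimately show ?thesis
            unfolding E_eq G_eq low_region_def by auto
        qed
        then show "indicator (E j) (x(j := y)) = (indicator {c..u} y * indicator (low_region I' b y) x :: ennreal)"
          by (auto simp: indicator_def)
      qed
      also have "\<dots> = (\<integral>\<^sup>+y. indicator {c..u} y * emeasure (?P I') (low_region I' b y) \<partial>unif01)"
        by (intro nn_integral_cong) (simp add: nn_integral_cmult_indicator nn_integral_cmult sets_low_region I')
      also have "\<dots> \<le> (\<integral>\<^sup>+y. ennreal (g n y / K) * indicator {c..u} y \<partial>unif01)"
      proof (rule nn_integral_mono)
        fix y
        show "indicator {c..u} y * emeasure (?P I') (low_region I' b y) \<le> ennreal (g n y / K) * indicator {c..u} y"
        proof (cases "y \<in> {c..u}")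
          case True
          have "emeasure (?P I') (low_region I' b y) \<le> ennreal (g (card I') y / K)"
          proof (intro Suc.hyps(1))
            show "n = card I'" "finite I'" "0 \<le> y" "y \<le> 1" using I' c True Suc.prems(3) by auto
            fix k t assume "1 \<le> k" "k \<le> card I'" "0 \<le> t" "t \<le> b k" "t \<le> (1::real)"
            then show "K * t ^ k \<le> g k t" using I'(4) Suc.hyps(2) by (intro Suc.prems(4)) auto
          qed
          then show ?thesis using True I' by (simp add: mult.commute)
        qed simp
      qed
      also have "\<dots> = (\<integral>\<^sup>+y. ennreal (g n y / K) * indicator {c..u} y \<partial>lborel)"
        by (rule nn_integral_unif01_interval) (use meas c Suc.prems in auto)
      also have "\<dots> = ennreal (g (Suc n) u / (real (Suc n) * K) - g (Suc n) c / (real (Suc n) * K))"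
      proof (rule nn_integral_FTC_Icc)
        show "(\<lambda>y. g n y / K) \<in> borel_measurable borel" using meas by simp
        show "c \<le> u" by (rule c)
        fix y assume "y \<in> {c..u}"
        then have y: "c \<le> y" "y \<le> u" by auto
        show "0 \<le> g n y / K" using nonneg[of y n] y c Suc.prems K by auto
        have "((\<lambda>y. g (Suc n) y / (real (Suc n) * K)) has_real_derivative real (Suc n) * g n y / (real (Suc n) * K)) (at y)"
          by (rule DERIV_cdivide[OF deriv]) (use y c Suc.prems in auto)
        moreover have "real (Suc n) * g n y / (real (Suc n) * K) = g n y / K" by simp
        ultimately show "((\<lambda>y. g (Suc n) y / (real (Suc n) * K)) has_real_derivative g n y / K) (at y)"
          by metis
      qed
      finally show ?thesis using E_sets by (simp add: diff_divide_distrib)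
    qed
    have "g (Suc n) c \<le> g (Suc n) u"
      by (rule DERIV_nonneg_imp_nondecreasing[OF c(2)])
        (metis deriv nonneg c(1) Suc.prems(3) mult_nonneg_nonneg of_nat_0_le_iff order_trans)
    have UE: "(\<Union>j\<in>I. E j) \<in> sets (?P I)"
      by (rule sets.finite_UN[OF fin]) (use E in blast)
    have "emeasure (?P I) (low_region I b u) \<le> emeasure (?P I) (PiE I (\<lambda>_. {0..c}) \<union> (\<Union>j\<in>I. E j))"
      by (rule emeasure_mono[OF cover sets.Un[OF box_sets UE]])
    also have "\<dots> \<le> emeasure (?P I) (PiE I (\<lambda>_. {0..c})) + emeasure (?P I) (\<Union>j\<in>I. E j)"
      by (rule emeasure_subadditive[OF box_sets UE])
    also have "\<dots> \<le> ennreal (c ^ card I) + (\<Sum>j\<in>I. emeasure (?P I) (E j))"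
      using emeasure_unif01_box[OF fin c(1,3)] E
      by (intro add_mono emeasure_subadditive_finite[OF fin]) (simp, blast)
    also have "\<dots> \<le> ennreal (g (Suc n) c / K) + (\<Sum>j\<in>I. ennreal ((g (Suc n) u - g (Suc n) c) / (real (Suc n) * K)))"
    proof (intro add_mono sum_mono ennreal_leI)
      \<comment> \<open>Either \<open>c\<close> is the top level, where the crossing hypothesis
        applies, or \<open>c = 0\<close> and the left side vanishes.\<close>
      have "K * c ^ Suc n \<le> g (Suc n) c"
      proof (cases "b (Suc n) \<ge> 0")
        case True
        then show ?thesis using Suc.prems(4)[of "Suc n" c] Suc.hyps(2) c by (auto simp: c_def)
      next
        case False
        then show ?thesis using nonneg[of 0 "Suc n"] by (auto simp: c_def)
      qed
      then show "c ^ card I \<le> g (Suc n) c / K" using K Suc.hyps(2)[symmetric] by (simp add: field_simps)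
    qed (use E in blast)
    \<comment> \<open>The \<open>Suc n\<close> equal contributions cancel the denominator, and the
      two values at \<open>c\<close> cancel each other.\<close>
    also have "\<dots> = ennreal (g (Suc n) c / K + real (Suc n) * ((g (Suc n) u - g (Suc n) c) / (real (Suc n) * K)))"
      using \<open>g (Suc n) c \<le> g (Suc n) u\<close> K nonneg[of c "Suc n"] c Suc.hyps(2)[symmetric]
      by (simp add: ennreal_of_nat_eq_real_of_nat ennreal_mult[symmetric] ennreal_plus[symmetric] del: ennreal_plus of_nat_Suc)
    also have "\<dots> = ennreal (g (card I) u / K)"
      using Suc.hyps(2)[symmetric] K by (simp add: field_simps del: of_nat_Suc)
    finally show ?thesis .
  qed
qed

section \<open>Choice of the martingale parameter\<close>

text \<open>The exponential generating function of the Bernoulli numbers. It arises because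
  \<open>exp w = 1 + a / v\<close> gives \<open>v * w = a * bernoulli_gen w\<close>.\<close>

definition bernoulli_gen :: "real \<Rightarrow> real" where
  "bernoulli_gen w = w / (exp w - 1)"

definition bernoulli_gen' :: "real \<Rightarrow> real" where
  "bernoulli_gen' w = 1 / (exp w - 1) - w * exp w / (exp w - 1)\<^sup>2"

lemma bernoulli_gen_deriv:
  assumes "0 < w"
  shows "(bernoulli_gen has_real_derivative bernoulli_gen' w) (at w)"
proof -
  have e: "exp w - 1 \<noteq> 0" using assms by simp
  have "((\<lambda>w. w / (exp w - 1)) has_real_derivative (1 * (exp w - 1) - w * exp w) / ((exp w - 1) * (exp w - 1))) (at w)"
    using e by (auto intro!: derivative_eq_intros)
  also have "(1 * (exp w - 1) - w * exp w) / ((exp w - 1) * (exp w - 1)) = bernoulli_gen' w"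
    using e unfolding bernoulli_gen'_def diff_divide_distrib power2_eq_square by simp
  finally show ?thesis unfolding bernoulli_gen_def .
qed

lemma exp_mult_diff_one_pos:
  assumes "0 < (w::real)" shows "0 < exp w * (w - 1) + 1"
proof -
  have "exp 0 * (0 - 1) + 1 < exp w * (w - 1) + (1::real)"
  proof (rule DERIV_pos_imp_increasing_open[OF assms])
    fix x :: real assume "0 < x"
    moreover have "((\<lambda>x. exp x * (x - 1) + (1::real)) has_real_derivative x * exp x) (at x)"
      by (auto intro!: derivative_eq_intros simp: algebra_simps)
    ultimately show "\<exists>y. ((\<lambda>x. exp x * (x - 1) + (1::real)) has_real_derivative y) (at x) \<and> 0 < y"
      by (meson exp_gt_zero mult_pos_pos)
  qed (auto intro!: continuous_intros)
  then show ?thesis by simp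
qed

text \<open>Up to positive factors this is the second derivative of \<open>bernoulli_gen\<close>;
  its own derivative is the expression of the preceding lemma.\<close>

lemma exp_mult_diff_two_nonneg:
  assumes "0 \<le> (w::real)" shows "0 \<le> exp w * (w - 2) + w + 2"
proof -
  have "exp 0 * (0 - 2) + 0 + 2 \<le> exp w * (w - 2) + w + (2::real)"
  proof (rule DERIV_nonneg_imp_nondecreasing[OF assms])
    fix x :: real assume "0 \<le> x"
    then have "0 \<le> exp x * (x - 1) + 1"
      using exp_mult_diff_one_pos[of x] by (cases "x = 0") auto
    moreover have "((\<lambda>x. exp x * (x - 2) + x + (2::real)) has_real_derivative exp x * (x - 1) + 1) (at x)"
      by (auto intro!: derivative_eq_intros simp: algebra_simps)
    ultimately show "\<exists>y. ((\<lambda>x. exp x * (x - 2) + x + (2::real)) has_real_derivative y) (at x) \<and> 0 \<le> y"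
      by blast
  qed
  then show ?thesis by simp
qed

lemma bernoulli_gen_tangent:
  assumes "0 < w" "0 < v"
  shows "bernoulli_gen v + bernoulli_gen' v * (w - v) \<le> bernoulli_gen w"
proof -
  have conv: "convex_on {0<..} bernoulli_gen"
  proof (rule f''_ge0_imp_convex)
    fix x :: real assume x: "x \<in> {0<..}"
    then show "DERIV bernoulli_gen x :> bernoulli_gen' x" by (simp add: bernoulli_gen_deriv)
    have e: "exp x - 1 > 0" using x by simp
    then show "DERIV bernoulli_gen' x :> exp x * (exp x * (x - 2) + x + 2) / (exp x - 1) ^ 3"
      unfolding bernoulli_gen'_def
      apply (auto intro!: derivative_eq_intros)
      apply (simp add: divide_simps)
      apply (simp add: eval_nat_numeral algebra_simps)
      done
    show "exp x * (exp x * (x - 2) + x + 2) / (exp x - 1) ^ 3 \<ge> 0"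
      using e x exp_mult_diff_two_nonneg[of x] by simp
  qed (rule convex_real_interval)
  have "bernoulli_gen w - bernoulli_gen v \<ge> bernoulli_gen' v * (w - v)"
    by (rule convex_on_imp_above_tangent[OF conv])
      (use assms bernoulli_gen_deriv in \<open>auto simp: interior_open intro: has_field_derivative_at_within connected_Ioi\<close>)
  then show ?thesis by simp
qed

lemma bernoulli_gen'_neg:
  assumes "0 < w" shows "bernoulli_gen' w < 0"
proof -
  have e: "exp w - 1 > 0" using assms by simp
  then have "bernoulli_gen' w = - (exp w * (w - 1) + 1) / (exp w - 1)\<^sup>2"
    unfolding bernoulli_gen'_def by (simp add: divide_simps) (simp add: algebra_simps power2_eq_square)
  then show ?thesis using exp_mult_diff_one_pos[OF assms] e by (simp add: divide_neg_pos)
qed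

text \<open>The substitution \<open>w = ln (1 + a / v)\<close> turns the left side into \<open>a * bernoulli_gen w + e * w\<close>,
  which is convex in \<open>w\<close>.\<close>

lemma log_slope_lower_bound:
  assumes "0 < a" "0 < v" "0 < w" and stat: "a * bernoulli_gen' w = - e"
  shows "a * bernoulli_gen w + e * w \<le> (v + e) * ln (1 + a / v)"
proof -
  define w' where "w' = ln (1 + a / v)"
  have w': "0 < w'" "exp w' = 1 + a / v" using assms by (auto simp: w'_def add_pos_pos)
  have "a * (bernoulli_gen w + bernoulli_gen' w * (w' - w)) \<le> a * bernoulli_gen w'"
    using assms w' by (intro mult_left_mono bernoulli_gen_tangent) auto
  moreover have "a * bernoulli_gen' w * (w' - w) = - e * (w' - w)" using stat by simp
  moreover have "a * bernoulli_gen w' = v * w'"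
    using assms w' by (simp add: bernoulli_gen_def)
  ultimately show ?thesis unfolding w'_def[symmetric] by (simp add: algebra_simps)
qed

text \<open>The right side is the relative entropy of Bernoulli(\<open>x\<close>) with respect to
  Bernoulli(\<open>v\<close>). Its second derivative in \<open>x\<close> is
  \<open>1 / (x * (1 - x))\<close>, which is at least 4; value and first derivative vanish at
  \<open>x = v\<close>.\<close>

lemma Pinsker_bernoulli:
  fixes x v :: real
  assumes "0 < v" "v \<le> x" "x < 1"
  shows "2 * (x - v)\<^sup>2 \<le> x * ln (x / v) + (1 - x) * ln ((1 - x) / (1 - v))"
proof -
  define G where "G y = y * (ln y - ln v) + (1 - y) * (ln (1 - y) - ln (1 - v)) - 2 * (y - v)\<^sup>2" for y
  define l where "l y = (ln y - ln v) - (ln (1 - y) - ln (1 - v)) - 4 * (y - v)" for y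
  have l: "0 \<le> l y" if "v \<le> y" "y < 1" for y
  proof -
    have "l v \<le> l y"
    proof (rule DERIV_nonneg_imp_nondecreasing[OF that(1)])
      fix z assume z: "v \<le> z" "z \<le> y"
      have "(l has_real_derivative (1 / z + 1 / (1 - z) - 4)) (at z)"
        unfolding l_def using z that assms
        by (auto intro!: derivative_eq_intros simp: field_simps)
      moreover have "1 / z + 1 / (1 - z) - 4 = (1 - 2 * z)\<^sup>2 / (z * (1 - z))"
        using z that assms by (simp add: field_simps power2_eq_square)
      moreover have "\<dots> \<ge> 0" using z that assms by simp
      ultimately show "\<exists>d. (l has_real_derivative d) (at z) \<and> 0 \<le> d" by metis
    qed
    moreover have "l v = 0" using assms by (simp add: l_def)
    ultimately show ?thesis by simp
  qed
  have "G v \<le> G x"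
  proof (rule DERIV_nonneg_imp_nondecreasing[OF assms(2)])
    fix y assume y: "v \<le> y" "y \<le> x"
    have nz: "1 - y \<noteq> 0" "y \<noteq> 0" using y assms by auto
    have "(G has_real_derivative (ln y - ln v) + y * (1 / y) + (- (ln (1 - y) - ln (1 - v)) + (1 - y) * (- 1 / (1 - y)))
        - 2 * (2 * (y - v))) (at y)"
      unfolding G_def using y assms by (auto intro!: derivative_eq_intros)
    also have "(ln y - ln v) + y * (1 / y) + (- (ln (1 - y) - ln (1 - v)) + (1 - y) * (- 1 / (1 - y)))
        - 2 * (2 * (y - v)) = l y"
      unfolding l_def using nz by simp
    finally have "(G has_real_derivative l y) (at y)" .
    then show "\<exists>d. (G has_real_derivative d) (at y) \<and> 0 \<le> d" using l[of y] y assms by auto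
  qed
  moreover have "G v = 0" using assms by (simp add: G_def)
  ultimately show ?thesis using assms by (simp add: G_def ln_div)
qed

text \<open>The equation says that the derivative in \<open>v\<close> of the relative entropy of
  Bernoulli(\<open>v + e\<close>) with respect to Bernoulli(\<open>v\<close>) is zero.\<close>

lemma DKW_stationary_point:
  fixes e :: real
  assumes "0 < e" "e < 1"
  obtains v where "0 < v" "v < 1 - e"
    "ln ((v + e) * (1 - v) / (v * (1 - v - e))) = e / (v * (1 - v))"
proof -
  define F where "F v = ln ((v + e) * (1 - v) / (v * (1 - v - e))) - e / (v * (1 - v))" for v
  have e': "1 - e > 0" using assms by simp
  \<comment> \<open>Near 0 the term \<open>e / v\<close> dominates the logarithm.\<close>
  have "filterlim F at_bot (at_right 0)"
    unfolding F_def using assms e' by real_asymp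
  then have "eventually (\<lambda>v. F v < 0) (at_right 0)" by (simp add: filterlim_at_bot_dense)
  moreover have "eventually (\<lambda>v. v \<in> {0<..<1 - e}) (at_right 0)"
    using e' by (rule eventually_at_right_real)
  ultimately have "eventually (\<lambda>v. F v < 0 \<and> v \<in> {0<..<1 - e}) (at_right 0)" by (rule eventually_conj)
  then obtain v1 where v1: "F v1 < 0" "v1 \<in> {0<..<1 - e}"
    using eventually_happens' trivial_limit_at_right_real by (metis (mono_tags, lifting))
  \<comment> \<open>The other end of the interval, through \<open>y = 1 - e - v\<close>: here the
    logarithm blows up while the fraction stays bounded.\<close>
  have "filterlim (\<lambda>y. ln ((1 - y) * (e + y) / ((1 - e - y) * y)) - e / ((1 - e - y) * (e + y))) at_top (at_right 0)"
    using assms e' by real_asymp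
  then have "eventually (\<lambda>y. ln ((1 - y) * (e + y) / ((1 - e - y) * y)) - e / ((1 - e - y) * (e + y)) > 0) (at_right 0)"
    by (rule filterlim_at_top_dense[THEN iffD1, rule_format])
  moreover have "eventually (\<lambda>y. y \<in> {0<..<1 - e - v1}) (at_right 0)"
    using v1 by (intro eventually_at_right_real) auto
  ultimately have "eventually (\<lambda>y. ln ((1 - y) * (e + y) / ((1 - e - y) * y)) - e / ((1 - e - y) * (e + y)) > 0
     \<and> y \<in> {0<..<1 - e - v1}) (at_right 0)" by (rule eventually_conj)
  then obtain y where y: "ln ((1 - y) * (e + y) / ((1 - e - y) * y)) - e / ((1 - e - y) * (e + y)) > 0"
     "y \<in> {0<..<1 - e - v1}"
    using eventually_happens' trivial_limit_at_right_real by (metis (mono_tags, lifting))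
  define v2 where "v2 = 1 - e - y"
  have v2: "F v2 > 0" "v1 < v2" "v2 < 1 - e" using y unfolding F_def v2_def by (auto simp: add.commute)
  have "continuous_on {v1..v2} F"
    unfolding F_def using v1 v2 assms by (auto intro!: continuous_intros)
  then obtain v where v: "v1 \<le> v" "v \<le> v2" "F v = 0"
    using IVT'[of F v1 0 v2] v1 v2 by auto
  show thesis by (rule that[of v]) (use v v1 v2 in \<open>auto simp: F_def\<close>)
qed

text \<open>A crossing of the line \<open>n * (t + e)\<close> makes the logarithm of
  \<open>(1 + a / t) ^ k\<close> at least \<open>n\<close> times the right side. After subtracting
  \<open>n * ln (1 + a)\<close> from the initial value of the martingale, \<open>2 * n * e^2\<close>
  is left: this is Massart's exponent.\<close>

lemma DKW_exponent:
  fixes e :: real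
  assumes "0 < e" "e < 1"
  obtains a where "0 < a" "\<And>t. 0 < t \<Longrightarrow> ln (1 + a) + 2 * e\<^sup>2 \<le> (t + e) * ln (1 + a / t)"
proof -
  obtain v where v: "0 < v" "v < 1 - e"
    and st: "ln ((v + e) * (1 - v) / (v * (1 - v - e))) = e / (v * (1 - v))"
    using DKW_stationary_point[OF assms] by blast
  define x where "x = v + e"
  \<comment> \<open>With this \<open>a\<close>, the martingale at time \<open>v\<close> is the
    likelihood ratio of Bernoulli(\<open>x\<close>) against Bernoulli(\<open>v\<close>):
    \<open>1 + a / v\<close> is the odds ratio, \<open>w\<close> is its logarithm, and
    \<open>1 + a = (1 - v) / (1 - x)\<close>.\<close>
  define a where "a = e / (1 - x)"
  define w where "w = ln (x * (1 - v) / (v * (1 - x)))"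
  have x: "0 < x" "x < 1" "v < x" and e: "e = x - v" using v assms by (auto simp: x_def)
  have a: "0 < a" using assms x by (simp add: a_def)
  have ew: "exp w = x * (1 - v) / (v * (1 - x))" using x v assms by (simp add: w_def)
  have w: "w = e / (v * (1 - v))" using st by (simp add: w_def x_def algebra_simps)
  have w0: "0 < w" unfolding w using v assms by simp
  have em: "exp w - 1 = a / v"
    unfolding ew a_def e using x v by (simp add: field_simps)
  have B: "bernoulli_gen w = (1 - x) / (1 - v)"
    unfolding bernoulli_gen_def em unfolding w a_def using x v assms by (simp add: field_simps)
  have aB: "a * bernoulli_gen w = v * w" unfolding bernoulli_gen_def em using a by simp
  \<comment> \<open>Since \<open>v\<close> is stationary for the entropy, \<open>w\<close> is also
    stationary for \<open>a * bernoulli_gen w + e * w\<close>, which is what makes the tangent bound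
    valid for all \<open>t\<close>.\<close>
  have "bernoulli_gen' w = (1 - bernoulli_gen w * exp w) / (exp w - 1)"
    using w0 unfolding bernoulli_gen'_def bernoulli_gen_def
    by (simp add: diff_divide_distrib power2_eq_square)
  also have "bernoulli_gen w * exp w = x / v" unfolding B ew using x v by simp
  also have "(1 - x / v) / (exp w - 1) = - e / a"
    unfolding em e using v a by (simp add: field_simps)
  finally have B': "a * bernoulli_gen' w = - e" using a by simp
  have ln1a: "ln (1 + a) = ln ((1 - v) / (1 - x))"
    unfolding a_def e using x v by (simp add: field_simps)
  have "2 * e\<^sup>2 \<le> x * ln (x / v) + (1 - x) * ln ((1 - x) / (1 - v))"
    unfolding e by (rule Pinsker_bernoulli) (use x v in auto)
  also have "\<dots> = x * w - ln (1 + a)"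
  proof -
    have "w = (ln x + ln (1 - v)) - (ln v + ln (1 - x))"
      unfolding w_def using x v by (subst ln_div) (auto simp: ln_mult)
    then show ?thesis unfolding ln1a using x v by (simp add: ln_div) (simp add: algebra_simps)
  qed
  finally have key: "ln (1 + a) + 2 * e\<^sup>2 \<le> a * bernoulli_gen w + e * w"
    unfolding aB unfolding x_def by (simp add: algebra_simps)
  show thesis
    by (rule that[OF a]) (use key log_slope_lower_bound[OF a _ w0 B'] in force)
qed

text \<open>Here \<open>s\<close> stands for \<open>n * t\<close>. With
  \<open>w = ln (1 + L)\<close> one has \<open>c * bernoulli_gen w = 1\<close> and
  \<open>c * w = L\<close>, so the tangent bound is exactly \<open>L + A\<close>; this is where the
  constant \<open>C_KR\<close> comes from. \<open>A\<close> is determined by stationarity at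
  \<open>w\<close>.\<close>

lemma KR_exponent:
  fixes L :: real
  assumes "0 < L" and c: "c = L / ln (1 + L)"
  obtains A where "0 < A" "\<And>s. 0 < s \<Longrightarrow> L + A \<le> c * (1 + s) * ln (1 + A / s)"
proof -
  define w where "w = ln (1 + L)"
  have w: "0 < w" "exp w = 1 + L" using assms by (auto simp: w_def)
  define A where "A = - 1 / bernoulli_gen' w"
  have A: "0 < A" "A * bernoulli_gen' w = - 1" using bernoulli_gen'_neg[OF w(1)] by (auto simp: A_def divide_simps)
  have c0: "0 < c" using assms w unfolding w_def by simp
  have cB: "c * bernoulli_gen w = 1" "c * w = L"
    using assms w unfolding bernoulli_gen_def c w_def[symmetric] by auto
  show thesis
  proof (rule that[OF A(1)])
    fix s :: real assume "0 < s"
    have "A * bernoulli_gen w + 1 * w \<le> (s + 1) * ln (1 + A / s)"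
      by (rule log_slope_lower_bound) (use A w \<open>0 < s\<close> in auto)
    then have "c * (A * bernoulli_gen w + w) \<le> c * ((s + 1) * ln (1 + A / s))"
      using c0 by simp
    moreover have "c * (A * bernoulli_gen w + w) = A * (c * bernoulli_gen w) + c * w" by (simp add: algebra_simps)
    ultimately show "L + A \<le> c * (1 + s) * ln (1 + A / s)" by (simp add: cB algebra_simps)
  qed
qed

section \<open>Uniform bounds on the number of small null p-values\<close>

lemma h_fun_deriv: "0 < x \<Longrightarrow> (h_fun has_real_derivative ln x) (at x)"
  unfolding h_fun_def by (auto intro!: derivative_eq_intros)

lemma h_fun_strict_mono:
  assumes "1 \<le> x" "x < y" shows "h_fun x < h_fun y"
proof (rule DERIV_pos_imp_increasing_open[OF assms(2)])
  fix z assume "x < z" "z < y"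
  then show "\<exists>d. (h_fun has_real_derivative d) (at z) \<and> 0 < d"
    using assms h_fun_deriv[of z] by (intro exI[of _ "ln z"]) auto
next
  show "continuous_on {x..y} h_fun"
    using assms by (intro DERIV_continuous_on[of _ _ ln] has_field_derivative_at_within[OF h_fun_deriv]) auto
qed

lemma h_fun_mono: "1 \<le> x \<Longrightarrow> x \<le> y \<Longrightarrow> h_fun x \<le> h_fun y"
  using h_fun_strict_mono[of x y] by (cases "x = y") auto

lemma h_fun_1 [simp]: "h_fun 1 = 0"
  by (simp add: h_fun_def)

lemma h_inv_correct:
  assumes "0 < y" shows "1 < h_inv y" "h_fun (h_inv y) = y"
proof -
  have inj: "inj_on h_fun {1<..}"
    by (rule linorder_inj_onI) (auto dest: h_fun_strict_mono[rotated])
  have "h_fun 1 \<le> y" using assms by simp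
  moreover have "y \<le> h_fun (exp (1 + y))"
  proof -
    have "1 * y \<le> exp (1 + y) * y" using assms by (intro mult_right_mono) auto
    then show ?thesis by (simp add: h_fun_def)
  qed
  moreover have "continuous_on {1..exp (1 + y)} h_fun"
    by (intro DERIV_continuous_on[of _ _ ln] has_field_derivative_at_within[OF h_fun_deriv]) auto
  ultimately obtain x where x: "1 \<le> x" "h_fun x = y"
    using IVT'[of h_fun 1 y "exp (1 + y)"] assms by auto
  then have "x \<noteq> 1" using assms by auto
  then have x': "x \<in> {1<..}" using x by auto
  then have y: "y \<in> h_fun ` {1<..}" using x by auto
  show "1 < h_inv y" using the_inv_into_into[OF inj y] by (auto simp: h_inv_def)
  show "h_fun (h_inv y) = y" unfolding h_inv_def by (rule f_the_inv_into_f[OF inj y])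
qed

text \<open>Concavity of \<open>ln\<close> on the segment from 1 to \<open>1 + a / s\<close>, in
  which \<open>1 + a / t\<close> has weight \<open>s / t\<close>.\<close>

lemma mult_ln_one_add_div_mono:
  fixes a s t :: real
  assumes "0 < a" "0 < s" "s \<le> t"
  shows "s * ln (1 + a / s) \<le> t * ln (1 + a / t)"
proof -
  define r where "r = s / t"
  have r: "0 \<le> r" "r \<le> 1" using assms by (auto simp: r_def)
  have "(1 - r) * ln 1 + r * ln (1 + a / s) \<le> ln ((1 - r) *\<^sub>R 1 + r *\<^sub>R (1 + a / s))"
    using concave_onD[OF ln_concave r, of 1 "1 + a / s"] assms by (simp add: add_pos_pos)
  also have "(1 - r) *\<^sub>R 1 + r *\<^sub>R (1 + a / s) = 1 + a / t"
    using assms by (simp add: r_def field_simps)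
  finally show ?thesis using assms by (simp add: r_def field_simps)
qed

definition num_below :: "nat set \<Rightarrow> (nat \<Rightarrow> real) \<Rightarrow> real \<Rightarrow> real" where
  "num_below I q t = real (card {i \<in> I. q i \<le> t})"

lemma num_below_le: "finite I \<Longrightarrow> num_below I q t \<le> real (card I)"
  unfolding num_below_def by (auto intro: card_mono)

text \<open>The link back from levels to curves: with \<open>b\<close> the inverse of a curve,
  \<open>b k < t\<close> says that the count \<open>k\<close> at \<open>t\<close> is below the
  curve.\<close>

lemma num_below_not_low_set:
  assumes "\<not> low_set I b q" "num_below I q t = real k" "0 < k"
  shows "b k < t"
proof (rule ccontr)
  assume "\<not> b k < t"
  moreover have "card {i \<in> I. q i \<le> t} = k" using assms(2) by (simp add: num_below_def)
  moreover have "{i \<in> I. q i \<le> t} \<noteq> {}"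
    using \<open>card {i \<in> I. q i \<le> t} = k\<close> assms(3) by force
  ultimately have "low_set I b q"
    unfolding low_set_def by (intro exI[of _ "{i \<in> I. q i \<le> t}"]) auto
  then show False using assms(1) by simp
qed

lemma kappa_gt_1: "1 < kappa"
proof -
  have "(3::real)\<^sup>2 < pi\<^sup>2" using pi_gt3 by (intro power_strict_mono) auto
  then show ?thesis by (simp add: kappa_def)
qed

section \<open>Probabilities of crossing events for an independent uniform sample\<close>

locale uniform_sample = prob_space M for M :: "'a measure" +
  fixes p :: "nat \<Rightarrow> 'a \<Rightarrow> real" and I :: "nat set"
  assumes finite_I: "finite I" and I_nonempty: "I \<noteq> {}"
    and indep: "indep_vars (\<lambda>_. borel) p I"
    and range_p: "\<And>i \<omega>. i \<in> I \<Longrightarrow> \<omega> \<in> space M \<Longrightarrow> p i \<omega> \<in> {0..1}"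
    and uniform: "\<And>i. i \<in> I \<Longrightarrow> distr M borel (p i) = unif01"
begin

abbreviation "n \<equiv> real (card I)"

abbreviation "N \<omega> \<equiv> num_below I (\<lambda>i. p i \<omega>)"

definition low_event :: "(nat \<Rightarrow> real) \<Rightarrow> 'a set" where
  "low_event b = {\<omega> \<in> space M. low_set I b (\<lambda>i. p i \<omega>)}"

lemma n_pos: "0 < n"
  using finite_I I_nonempty by (simp add: card_gt_0_iff)

lemma measurable_p: "i \<in> I \<Longrightarrow> p i \<in> borel_measurable M"
  using indep by (auto simp: indep_vars_def)

lemma sets_low_event: "low_event b \<in> events"
  using pred_low_set[OF finite_I, of "\<lambda>\<omega> i. p i \<omega>" M b] measurable_p
  by (simp add: low_event_def pred_def)

lemma prob_low_event:
  fixes g :: "nat \<Rightarrow> real \<Rightarrow> real"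
  assumes "0 < K"
    and "\<And>k t. 0 \<le> t \<Longrightarrow> t \<le> 1 \<Longrightarrow> (g (Suc k) has_real_derivative real (Suc k) * g k t) (at t)"
    and "\<And>k. g k \<in> borel_measurable borel"
    and nonneg: "\<And>k t. 0 \<le> t \<Longrightarrow> t \<le> 1 \<Longrightarrow> 0 \<le> g k t"
    and "\<And>k t. 1 \<le> k \<Longrightarrow> k \<le> card I \<Longrightarrow> 0 \<le> t \<Longrightarrow> t \<le> b k \<Longrightarrow> t \<le> 1 \<Longrightarrow> K * t ^ k \<le> g k t"
  shows "prob (low_event b) \<le> g (card I) 1 / K"
proof -
  let ?X = "\<lambda>\<omega>. \<lambda>i\<in>I. p i \<omega>"
  let ?P = "PiM I (\<lambda>_. borel) :: (nat \<Rightarrow> real) measure"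
  have "distr M ?P ?X = PiM I (\<lambda>i. distr M borel (p i))"
    using indep_vars_iff_distr_eq_PiM'[OF I_nonempty, where M' = "\<lambda>_. borel" and X = p] measurable_p indep by simp
  also have "\<dots> = PiM I (\<lambda>_. unif01)"
    by (rule PiM_cong) (use uniform in auto)
  finally have distr: "distr M ?P ?X = PiM I (\<lambda>_. unif01)" .
  have X: "?X \<in> M \<rightarrow>\<^sub>M ?P"
    by (rule measurable_restrict) (use measurable_p in auto)
  have region: "low_region I b 1 \<in> sets ?P"
    using sets_low_region[OF finite_I, of b 1] sets_distr[of M ?P ?X] unfolding distr by simp
  have "low_event b = ?X -` low_region I b 1 \<inter> space M"
  proof -
    have "low_set I b (?X \<omega>) = low_set I b (\<lambda>i. p i \<omega>)" for \<omega>
      by (rule low_set_cong) simp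
    then show ?thesis using range_p by (auto simp: low_event_def low_region_def)
  qed
  then have "emeasure M (low_event b) = emeasure (PiM I (\<lambda>_. unif01)) (low_region I b 1)"
    using emeasure_distr[OF X region] distr by simp
  also have "\<dots> \<le> ennreal (g (card I) 1 / K)"
    by (rule emeasure_low_region) (use assms finite_I in auto)
  finally show ?thesis
    using nonneg[of 1 "card I"] assms(1) by (simp add: emeasure_eq_measure)
qed

text \<open>Instance \<open>g k t = (t + a) ^ k\<close>. The martingale
  \<open>(1 + a / t) ^ N t\<close> starts at time 1 from \<open>(1 + a) ^ card I\<close> and must
  reach \<open>K\<close> for a crossing.\<close>

lemma prob_low_event_exp:
  assumes "0 < a" "0 < K"
    and cross: "\<And>k t. 1 \<le> k \<Longrightarrow> 0 < t \<Longrightarrow> t \<le> b k \<Longrightarrow> t \<le> 1 \<Longrightarrow> K \<le> (1 + a / t) ^ k"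
  shows "prob (low_event b) \<le> (1 + a) ^ card I / K"
proof (rule prob_low_event[where g = "\<lambda>k t. (t + a) ^ k"])
  fix k t assume k: "1 \<le> k" "k \<le> card I" and t: "0 \<le> t" "t \<le> b k" "t \<le> (1::real)"
  show "K * t ^ k \<le> (t + a) ^ k"
  proof (cases "t = 0")
    case False
    then have "K * t ^ k \<le> (1 + a / t) ^ k * t ^ k" using cross k t by (intro mult_right_mono) auto
    also have "\<dots> = (t + a) ^ k" using False by (simp add: power_mult_distrib[symmetric] field_simps)
    finally show ?thesis .
  qed (use k assms in \<open>auto simp: power_0_left\<close>)
next
  fix k and t :: real
  have "((\<lambda>t. (t + a) ^ Suc k) has_real_derivative (1 + real k) * (1 * (t + a) ^ k)) (at t)"
    by (rule DERIV_power_Suc) (auto intro!: derivative_eq_intros)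
  then show "((\<lambda>t. (t + a) ^ Suc k) has_real_derivative real (Suc k) * (t + a) ^ k) (at t)" by simp
qed (use assms in auto)

lemma prob_low_event_ratio:
  assumes "0 < K"
    and cross: "\<And>k t. 1 \<le> k \<Longrightarrow> 0 < t \<Longrightarrow> t \<le> b k \<Longrightarrow> K * t \<le> real k"
  shows "prob (low_event b) \<le> n / K"
proof -
  have "prob (low_event b) \<le> n * 1 ^ (card I - 1) / K"
  \<comment> \<open>This \<open>g\<close> is the derivative of \<open>(t + a) ^ k\<close> in
    \<open>a\<close> at \<open>a = 0\<close>. Truncated subtraction is harmless at
    \<open>k = 0\<close>, where the factor \<open>real k\<close> gives 0, as the derivative of the
    constant \<open>g 1\<close> requires.\<close>
  proof (rule prob_low_event[where g = "\<lambda>k t. real k * t ^ (k - 1)"])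
    fix k and t :: real
    have "((\<lambda>t. real (Suc k) * t ^ k) has_real_derivative real (Suc k) * (real k * t ^ (k - 1))) (at t)"
      by (auto intro!: derivative_eq_intros)
    then show "((\<lambda>t. real (Suc k) * t ^ (Suc k - 1)) has_real_derivative real (Suc k) * (real k * t ^ (k - 1))) (at t)"
      by simp
  next
    fix k t assume k: "1 \<le> k" "k \<le> card I" and t: "0 \<le> t" "t \<le> b k" "t \<le> (1::real)"
    have "K * t * t ^ (k - 1) \<le> real k * t ^ (k - 1)"
      using cross[of k t] k t by (intro mult_right_mono) (cases "t = 0"; auto)+
    then show "K * t ^ k \<le> real k * t ^ (k - 1)" using k by (cases k) (auto simp: mult.assoc)
  qed (use assms in auto)
  then show ?thesis by simp
qed

lemma Simes_event:
  assumes "0 < \<delta>" "\<delta> < 1"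
  obtains B where "B \<in> events" "prob B \<le> \<delta>"
    "\<And>\<omega> t. \<omega> \<in> space M - B \<Longrightarrow> 0 \<le> t \<Longrightarrow> N \<omega> t \<le> n * t / \<delta>"
proof -
  \<comment> \<open>At or below this level the ratio \<open>k / t\<close> is at least
    \<open>n / \<delta>\<close>, while its initial value is \<open>n\<close>.\<close>
  define b where "b k = real k * \<delta> / n" for k
  have "prob (low_event b) \<le> n / (n / \<delta>)"
    by (rule prob_low_event_ratio) (use n_pos assms in \<open>auto simp: b_def field_simps\<close>)
  then have "prob (low_event b) \<le> \<delta>" using n_pos assms by simp
  moreover have "N \<omega> t \<le> n * t / \<delta>" if "\<omega> \<in> space M - low_event b" "0 \<le> t" for \<omega> t
  proof (cases "N \<omega> t = 0")
    case False
    obtain k where k: "N \<omega> t = real k" by (auto simp: num_below_def)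
    have "b k < t" by (rule num_below_not_low_set[OF _ k]) (use that k False in \<open>auto simp: low_event_def\<close>)
    then show ?thesis unfolding k b_def using n_pos assms by (simp add: field_simps)
  qed (use that assms in auto)
  ultimately show thesis using that sets_low_event by blast
qed

lemma DKW_event:
  assumes "0 < \<delta>" "\<delta> < 1"
  obtains B where "B \<in> events" "prob B \<le> \<delta>"
    "\<And>\<omega> t. \<omega> \<in> space M - B \<Longrightarrow> 0 \<le> t \<Longrightarrow> N \<omega> t \<le> n * t + sqrt (n * (ln (1 / \<delta>) / 2))"
proof -
  define L where "L = ln (1 / \<delta>)"
  have L: "0 < L" using assms by (simp add: L_def)
  \<comment> \<open>Solves \<open>exp (- 2 * n * e^2) = \<delta>\<close>.\<close>
  define e where "e = sqrt (L / (2 * n))"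
  have e: "0 < e" "e\<^sup>2 = L / (2 * n)" using L n_pos by (auto simp: e_def)
  have ne: "n * e = sqrt (n * (L / 2))"
  proof -
    have "sqrt (n * (L / 2)) = sqrt (n\<^sup>2 * (L / (2 * n)))" using n_pos by (simp add: power2_eq_square)
    also have "\<dots> = n * e" using n_pos unfolding e_def by (subst real_sqrt_mult) simp
    finally show ?thesis by simp
  qed
  show thesis
  proof (cases "e < 1")
    case False
    \<comment> \<open>A deviation \<open>n * e >= n\<close> cannot be exceeded by a count of
      \<open>n\<close> points, so the empty exceptional event suffices.\<close>
    have "N \<omega> t \<le> n * t + n * e" if "0 \<le> t" for \<omega> t
    proof -
      have "N \<omega> t \<le> n * 1" using num_below_le[OF finite_I] by simp
      also have "\<dots> \<le> n * e" using False n_pos by (intro mult_left_mono) auto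
      finally show ?thesis using that n_pos by (smt (verit) mult_nonneg_nonneg)
    qed
    then show thesis using that[of "{}"] assms unfolding ne L_def by auto
  next
    case True
    obtain a where a: "0 < a" "\<And>t. 0 < t \<Longrightarrow> ln (1 + a) + 2 * e\<^sup>2 \<le> (t + e) * ln (1 + a / t)"
      using DKW_exponent[OF e(1) True] by blast
    define b where "b k = real k / n - e" for k
    define K where "K = exp (n * (ln (1 + a) + 2 * e\<^sup>2))"
    have "prob (low_event b) \<le> (1 + a) ^ card I / K"
    proof (rule prob_low_event_exp[OF a(1)])
      fix k t assume "1 \<le> k" and t: "0 < t" "t \<le> b k" "t \<le> 1"
      have ln0: "0 \<le> ln (1 + a / t)" using a t by simp
      have "n * (ln (1 + a) + 2 * e\<^sup>2) \<le> n * ((t + e) * ln (1 + a / t))"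
        using n_pos a(2)[OF t(1)] by (intro mult_left_mono) auto
      also have "\<dots> = (n * (t + e)) * ln (1 + a / t)" by simp
      also have "\<dots> \<le> real k * ln (1 + a / t)"
        using t n_pos ln0 by (intro mult_right_mono) (auto simp: b_def field_simps)
      also have "\<dots> = ln ((1 + a / t) ^ k)" using a t by (simp add: ln_realpow add_pos_pos)
      finally have "K \<le> exp (ln ((1 + a / t) ^ k))" unfolding K_def by simp
      also have "\<dots> = (1 + a / t) ^ k" using a t by (simp add: add_pos_pos)
      finally show "K \<le> (1 + a / t) ^ k" .
    qed (simp add: K_def)
    also have "(1 + a) ^ card I / K = exp (- L)"
    proof -
      have "(1 + a) ^ card I = exp (n * ln (1 + a))" using a by (simp add: exp_of_nat_mult)
      then have "(1 + a) ^ card I / K = exp (- (n * (2 * e\<^sup>2)))"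
        unfolding K_def by (simp add: exp_diff[symmetric] algebra_simps)
      then show ?thesis unfolding e(2) using n_pos by simp
    qed
    also have "\<dots> = \<delta>" using assms by (simp add: L_def ln_div)
    finally have "prob (low_event b) \<le> \<delta>" .
    moreover have "N \<omega> t \<le> n * t + n * e" if "\<omega> \<in> space M - low_event b" "0 \<le> t" for \<omega> t
    proof (cases "N \<omega> t = 0")
      case False
      obtain k where k: "N \<omega> t = real k" by (auto simp: num_below_def)
      have "b k < t" by (rule num_below_not_low_set[OF _ k]) (use that k False in \<open>auto simp: low_event_def\<close>)
      then show ?thesis unfolding k b_def using n_pos by (simp add: field_simps)
    qed (use that n_pos e in auto)
    ultimately show thesis using that sets_low_event unfolding ne L_def by blast
  qed
qed

lemma KR_event:
  assumes "0 < \<delta>" "\<delta> < 1"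
  obtains B where "B \<in> events" "prob B \<le> \<delta>"
    "\<And>\<omega> t. \<omega> \<in> space M - B \<Longrightarrow> 0 \<le> t \<Longrightarrow> N \<omega> t \<le> C_KR \<delta> * (1 + n * t)"
proof -
  define L where "L = ln (1 / \<delta>)"
  have L: "0 < L" using assms by (simp add: L_def)
  define c where "c = L / ln (1 + L)"
  have c: "0 < c" using L by (simp add: c_def)
  obtain A where A: "0 < A" "\<And>s. 0 < s \<Longrightarrow> L + A \<le> c * (1 + s) * ln (1 + A / s)"
    using KR_exponent[OF L c_def] by blast
  define a where "a = A / n"
  have a: "0 < a" using A n_pos by (simp add: a_def)
  define b where "b k = (real k - c) / (c * n)" for k
  define K where "K = exp (L + A)"
  have "prob (low_event b) \<le> (1 + a) ^ card I / K"
  proof (rule prob_low_event_exp[OF a])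
    fix k t assume "1 \<le> k" and t: "0 < t" "t \<le> b k" "t \<le> 1"
    have ln0: "0 \<le> ln (1 + a / t)" using a t by simp
    have "L + A \<le> c * (1 + n * t) * ln (1 + A / (n * t))"
      using n_pos A(2)[of "n * t"] t by simp
    also have "\<dots> = c * (1 + n * t) * ln (1 + a / t)" by (simp add: a_def)
    also have "\<dots> \<le> real k * ln (1 + a / t)"
      using t n_pos ln0 c by (intro mult_right_mono) (auto simp: b_def field_simps)
    also have "\<dots> = ln ((1 + a / t) ^ k)" using a t by (simp add: ln_realpow add_pos_pos)
    finally have "K \<le> exp (ln ((1 + a / t) ^ k))" unfolding K_def by simp
    also have "\<dots> = (1 + a / t) ^ k" using a t by (simp add: add_pos_pos)
    finally show "K \<le> (1 + a / t) ^ k" .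
  qed (simp add: K_def)
  also have "(1 + a) ^ card I / K \<le> exp A / K"
  proof (intro divide_right_mono)
    \<comment> \<open>The passage from the binomial to the Poisson generating function;
      \<open>A = n * a\<close> was chosen for the latter.\<close>
    have "(1 + a) ^ card I \<le> exp a ^ card I" using a by (intro power_mono) auto
    also have "\<dots> = exp A" using n_pos by (simp add: exp_of_nat_mult[symmetric] a_def)
    finally show "(1 + a) ^ card I \<le> exp A" .
  qed (simp add: K_def)
  also have "\<dots> = exp (- L)" unfolding K_def by (simp add: exp_diff[symmetric])
  also have "\<dots> = \<delta>" using assms by (simp add: L_def ln_div)
  finally have "prob (low_event b) \<le> \<delta>" .
  moreover have "N \<omega> t \<le> c * (1 + n * t)" if "\<omega> \<in> space M - low_event b" "0 \<le> t" for \<omega> t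
  proof (cases "N \<omega> t = 0")
    case False
    obtain k where k: "N \<omega> t = real k" by (auto simp: num_below_def)
    have "b k < t" by (rule num_below_not_low_set[OF _ k]) (use that k False in \<open>auto simp: low_event_def\<close>)
    then show ?thesis unfolding k b_def using n_pos c by (simp add: field_simps)
  qed (use that n_pos c in auto)
  moreover have "c = C_KR \<delta>" by (simp add: c_def C_KR_def L_def)
  ultimately show thesis using that sets_low_event by blast
qed

lemma Wellner_event:
  assumes "1 < l" "0 < s"
  obtains B where "B \<in> events" "prob B \<le> exp (- (n * s * h_fun l))"
    "\<And>\<omega> t. \<omega> \<in> space M - B \<Longrightarrow> s \<le> t \<Longrightarrow> N \<omega> t \<le> l * n * t"
proof -
  \<comment> \<open>Makes \<open>1 + a / s = l\<close>. At the left end \<open>s\<close>, the least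
    favourable point of the line, this gives the Poisson exponent
    \<open>n * s * h_fun l\<close>.\<close>
  define a where "a = s * (l - 1)"
  have a: "0 < a" using assms by (simp add: a_def)
  have as: "1 + a / s = l" using assms by (simp add: a_def)
  \<comment> \<open>Only \<open>t >= s\<close> is to be controlled, so counts that the line already
    allows at \<open>s\<close> get a negative level, which no point can meet.\<close>
  define b where "b k = (if real k > l * n * s then real k / (l * n) else -1)" for k
  define K where "K = exp (l * n * (s * ln l))"
  have "prob (low_event b) \<le> (1 + a) ^ card I / K"
  proof (rule prob_low_event_exp[OF a])
    fix k t assume "1 \<le> k" and t: "0 < t" "t \<le> b k" "t \<le> 1"
    define T where "T = real k / (l * n)"
    have kl: "real k > l * n * s" using t by (auto simp: b_def split: if_splits)
    then have tT: "t \<le> T" using t by (simp add: b_def T_def)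
    have T: "s \<le> T" "real k = l * n * T" using kl n_pos assms by (auto simp: T_def field_simps)
    have T0: "0 < T" using t tT by linarith
    have "l * n * (s * ln l) \<le> l * n * (T * ln (1 + a / T))"
      using mult_ln_one_add_div_mono[OF a assms(2) T(1)] n_pos assms unfolding as by (intro mult_left_mono) auto
    also have "\<dots> = real k * ln (1 + a / T)" by (simp add: T)
    also have "\<dots> \<le> real k * ln (1 + a / t)"
      using a t T0 tT by (intro mult_left_mono ln_mono) (auto intro!: divide_left_mono add_pos_pos)
    also have "\<dots> = ln ((1 + a / t) ^ k)" using a t by (simp add: ln_realpow add_pos_pos)
    finally have "K \<le> exp (ln ((1 + a / t) ^ k))" unfolding K_def by simp
    also have "\<dots> = (1 + a / t) ^ k" using a t by (simp add: add_pos_pos)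
    finally show "K \<le> (1 + a / t) ^ k" .
  qed (simp add: K_def)
  also have "\<dots> \<le> exp (n * a) / K"
  proof (intro divide_right_mono)
    have "(1 + a) ^ card I \<le> exp a ^ card I" using a by (intro power_mono) auto
    then show "(1 + a) ^ card I \<le> exp (n * a)" by (simp add: exp_of_nat_mult)
  qed (simp add: K_def)
  also have "\<dots> = exp (- (n * s * h_fun l))"
    unfolding K_def by (simp add: exp_diff[symmetric] h_fun_def a_def algebra_simps)
  finally have "prob (low_event b) \<le> exp (- (n * s * h_fun l))" .
  moreover have "N \<omega> t \<le> l * n * t" if "\<omega> \<in> space M - low_event b" "s \<le> t" for \<omega> t
  proof (rule ccontr)
    assume less: "\<not> N \<omega> t \<le> l * n * t"
    obtain k where k: "N \<omega> t = real k" by (auto simp: num_below_def)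
    have ln0: "0 < l * n" using assms n_pos by simp
    have kl: "real k > l * n * t" using less k by simp
    moreover have "l * n * s \<le> l * n * t" using that ln0 by (intro mult_left_mono) auto
    moreover have "0 < l * n * s" using ln0 assms by simp
    ultimately have bk: "b k = real k / (l * n)" "0 < k" by (auto simp: b_def)
    have "b k < t" by (rule num_below_not_low_set[OF _ k bk(2)]) (use that in \<open>auto simp: low_event_def\<close>)
    then show False using kl ln0 unfolding bk by (simp add: field_simps)
  qed
  ultimately show thesis using that sets_low_event by blast
qed

text \<open>At an ordered p-value 0 the Wellner bound is read as 0, so null p-values equal to 0 have
  to be excluded almost surely.\<close>

lemma prob_low_event_zero: "prob (low_event (\<lambda>_. 0)) = 0"
proof (rule ccontr)
  assume "prob (low_event (\<lambda>_. 0)) \<noteq> 0"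
  then have pos: "0 < prob (low_event (\<lambda>_. 0))" (is "0 < ?x") using measure_nonneg[of M "low_event (\<lambda>_. 0)"] by linarith
  \<comment> \<open>No positive \<open>t\<close> is below the level 0, so the crossing condition is
    vacuous and every \<open>K\<close> is admissible; this one bounds \<open>?x\<close> by
    \<open>?x / 2\<close>.\<close>
  have "?x \<le> n / (2 * n / ?x)"
    by (rule prob_low_event_ratio) (use pos n_pos in auto)
  then show False using pos n_pos by simp
qed

lemma Well_event:
  assumes "0 < \<delta>" "\<delta> < 1"
  obtains B where "B \<in> events" "prob B \<le> \<delta>"
    "\<And>\<omega> t. \<omega> \<in> space M - B \<Longrightarrow> t \<le> 0 \<Longrightarrow> N \<omega> t = 0"
    "\<And>\<omega> t. \<omega> \<in> space M - B \<Longrightarrow> 0 < t \<Longrightarrow> t \<le> 1 \<Longrightarrow> n * t < N \<omega> t \<Longrightarrow>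
        n * t * h_fun (N \<omega> t / (n * t)) \<le> C_Well \<delta> t"
proof -
  define s where "s j = (1 / 2 :: real) ^ Suc j" for j
  \<comment> \<open>Chosen so that \<open>exp (- x j) = (\<delta> / kappa) / (j + 1)^2\<close>,
    whose sum is \<open>\<delta>\<close> by Euler's value of the sum of inverse squares. The slope
    \<open>l j\<close> then gives the line used on \<open>{s j..}\<close> failure probability at
    most \<open>exp (- x j)\<close>.\<close>
  define x where "x j = ln (kappa / \<delta>) + 2 * ln (1 + real j)" for j :: nat
  define l where "l j = h_inv (x j / (n * s j))" for j
  have s: "0 < s j" for j by (simp add: s_def)
  have lk: "0 < ln (kappa / \<delta>)" using kappa_gt_1 assms by simp
  then have x: "0 < x j" for j unfolding x_def by (intro add_pos_nonneg) auto
  have l: "1 < l j" "h_fun (l j) = x j / (n * s j)" for j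
    using h_inv_correct[of "x j / (n * s j)"] s[of j] x[of j] n_pos by (auto simp: l_def)
  define Q where "Q j B \<longleftrightarrow> B \<in> events \<and> prob B \<le> exp (- x j) \<and>
    (\<forall>\<omega> \<in> space M - B. \<forall>t\<ge>s j. N \<omega> t \<le> l j * n * t)" for j B
  have "\<exists>B. Q j B" for j
  proof -
    obtain B where "B \<in> events" "prob B \<le> exp (- (n * s j * h_fun (l j)))"
      "\<And>\<omega> t. \<omega> \<in> space M - B \<Longrightarrow> s j \<le> t \<Longrightarrow> N \<omega> t \<le> l j * n * t"
      using Wellner_event[OF l(1) s] by blast
    moreover have "n * s j * h_fun (l j) = x j" using l(2)[of j] s[of j] n_pos by simp
    ultimately show ?thesis unfolding Q_def by auto
  qed
  then obtain B where "\<And>j. Q j (B j)" by metis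
  then have B: "\<And>j. B j \<in> events" "\<And>j. prob (B j) \<le> exp (- x j)"
    "\<And>j \<omega> t. \<omega> \<in> space M - B j \<Longrightarrow> s j \<le> t \<Longrightarrow> N \<omega> t \<le> l j * n * t"
    unfolding Q_def by auto
  have ex: "exp (- x j) = \<delta> / kappa * (1 / (real j + 1)\<^sup>2)" for j
  proof -
    have "exp (x j) = (kappa / \<delta>) * (1 + real j)\<^sup>2"
      unfolding x_def exp_add exp_double using kappa_gt_1 assms by simp
    then show ?thesis unfolding exp_minus by (simp add: divide_inverse add.commute)
  qed
  have sums: "(\<lambda>j. exp (- x j)) sums \<delta>"
  proof -
    have "(\<lambda>j. \<delta> / kappa * (1 / (real j + 1)\<^sup>2)) sums (\<delta> / kappa * (pi\<^sup>2 / 6))"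
      using inverse_squares_sums by (intro sums_mult) (simp add: add.commute)
    then show ?thesis unfolding ex using kappa_gt_1 by (simp add: kappa_def)
  qed
  have summ: "summable (\<lambda>j. prob (B j))"
    by (rule summable_comparison_test[OF _ sums_summable[OF sums]]) (use B in auto)
  have "prob (\<Union>j. B j) \<le> (\<Sum>j. prob (B j))"
    by (rule finite_measure_subadditive_countably) (use B summ in auto)
  also have "\<dots> \<le> (\<Sum>j. exp (- x j))"
    by (rule suminf_le[OF B(2) summ sums_summable[OF sums]])
  also have "\<dots> = \<delta>" using sums by (rule sums_unique[symmetric])
  finally have UB: "prob (\<Union>j. B j) \<le> \<delta>" .
  define Z where "Z = (\<Union>j. B j) \<union> low_event (\<lambda>_. 0)"
  have "prob Z \<le> prob (\<Union>j. B j) + prob (low_event (\<lambda>_. 0))"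
    unfolding Z_def using B sets_low_event by (intro measure_Un_le) auto
  then have "prob Z \<le> \<delta>" using UB prob_low_event_zero by simp
  moreover have "Z \<in> events" unfolding Z_def using B sets_low_event by auto
  moreover have "N \<omega> t = 0" if "\<omega> \<in> space M - Z" "t \<le> 0" for \<omega> t
  proof (rule ccontr)
    assume "N \<omega> t \<noteq> 0"
    moreover obtain k where k: "N \<omega> t = real k" by (auto simp: num_below_def)
    ultimately have "0 < t"
      using num_below_not_low_set[of I "\<lambda>_. 0" "\<lambda>i. p i \<omega>" t k] that
      by (auto simp: Z_def low_event_def)
    then show False using that by simp
  qed
  moreover have "n * t * h_fun (N \<omega> t / (n * t)) \<le> C_Well \<delta> t"
    if \<omega>: "\<omega> \<in> space M - Z" and t: "0 < t" "t \<le> 1" and less: "n * t < N \<omega> t" for \<omega> t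
  proof -
    \<comment> \<open>Selects the block with \<open>s j < t <= 2 * s j\<close>; \<open>t = 1\<close>
      falls in block 0.\<close>
    define j where "j = nat \<lfloor>log 2 (1 / t)\<rfloor>"
    have log0: "0 \<le> log 2 (1 / t)" using t by simp
    then have j: "real j \<le> log 2 (1 / t)" "log 2 (1 / t) < real j + 1" unfolding j_def by linarith+
    have "2 powr real j \<le> 1 / t" using j(1) t by (simp add: le_log_iff)
    moreover have "1 / t < 2 powr (real j + 1)" using j(2) t by (simp add: log_less_iff)
    ultimately have ts: "t \<le> 2 * s j" "s j \<le> t"
      using t by (auto simp: s_def powr_realpow powr_add field_simps power_divide)
    have nt: "0 < n * t" using n_pos t by simp
    have "N \<omega> t \<le> l j * n * t" using B(3)[of \<omega> j t] \<omega> ts by (auto simp: Z_def)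
    then have "h_fun (N \<omega> t / (n * t)) \<le> h_fun (l j)"
      using nt less by (intro h_fun_mono) (auto simp: field_simps)
    then have "n * t * h_fun (N \<omega> t / (n * t)) \<le> n * t * (x j / (n * s j))"
      using nt unfolding l(2) by (intro mult_left_mono) auto
    also have "\<dots> = (t / s j) * x j" using n_pos by simp
    \<comment> \<open>The loss of a factor 2 within a dyadic block produces the coefficients 2 and 4
      in \<open>C_Well\<close>.\<close>
    also have "\<dots> \<le> 2 * x j"
      using ts s[of j] x[of j] by (intro mult_right_mono) (auto simp: field_simps)
    also have "\<dots> \<le> C_Well \<delta> t"
    proof -
      have "ln (1 + real j) \<le> ln (1 + log 2 (1 / t))" using j by (intro ln_mono) auto
      then show ?thesis by (simp add: x_def C_Well_def)
    qed
    finally show ?thesis .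
  qed
  ultimately show thesis using that by blast
qed

end

section \<open>From the uniform bounds to the false discovery proportion\<close>

lemma card_le_eq_length_filter:
  "card {i \<in> {1..m}. q i \<le> c} = length (filter (\<lambda>x. x \<le> c) (sort (map q [1..<Suc m])))"
proof -
  have "length (filter (\<lambda>x. x \<le> c) (sort (map q [1..<Suc m]))) = length (filter (\<lambda>x. x \<le> c) (map q [1..<Suc m]))"
    by (metis mset_filter mset_sort size_mset)
  also have "\<dots> = length (filter (\<lambda>i. q i \<le> c) [1..<Suc m])"
    by (simp add: filter_map o_def)
  also have "\<dots> = card (set (filter (\<lambda>i. q i \<le> c) [1..<Suc m]))"
    by (rule distinct_card[symmetric]) simp
  also have "set (filter (\<lambda>i. q i \<le> c) [1..<Suc m]) = {i \<in> {1..m}. q i \<le> c}" by auto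
  finally show ?thesis by simp
qed

lemma ordered_pvalue_le_iff:
  assumes "k \<in> {1..m}"
  shows "ordered_pvalue m q k \<le> c \<longleftrightarrow> k \<le> card {i \<in> {1..m}. q i \<le> c}"
proof -
  define xs where "xs = sort (map q [1..<Suc m])"
  have xs: "sorted xs" "length xs = m" by (auto simp: xs_def)
  have ord: "ordered_pvalue m q k = xs ! (k - 1)" by (simp add: ordered_pvalue_def xs_def)
  have card: "card {i \<in> {1..m}. q i \<le> c} = card {j. j < m \<and> xs ! j \<le> c}"
    unfolding card_le_eq_length_filter xs_def[symmetric] length_filter_conv_card xs(2) ..
  show ?thesis
  proof
    assume "ordered_pvalue m q k \<le> c"
    then have le: "xs ! (k - 1) \<le> c" unfolding ord .
    have "{..<k} \<subseteq> {j. j < m \<and> xs ! j \<le> c}"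
    proof
      fix j assume "j \<in> {..<k}"
      then have "j < m" "xs ! j \<le> xs ! (k - 1)"
        using assms xs(2) sorted_nth_mono[OF xs(1), of j "k - 1"] by auto
      then show "j \<in> {j. j < m \<and> xs ! j \<le> c}" using le by auto
    qed
    then have "card {..<k} \<le> card {j. j < m \<and> xs ! j \<le> c}" by (intro card_mono) auto
    then show "k \<le> card {i \<in> {1..m}. q i \<le> c}" using card by simp
  next
    assume le: "k \<le> card {i \<in> {1..m}. q i \<le> c}"
    show "ordered_pvalue m q k \<le> c"
    proof (rule ccontr)
      assume "\<not> ordered_pvalue m q k \<le> c"
      then have less: "c < xs ! (k - 1)" by (simp add: ord)
      have "{j. j < m \<and> xs ! j \<le> c} \<subseteq> {..<k - 1}"
      proof
        fix j assume j: "j \<in> {j. j < m \<and> xs ! j \<le> c}"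
        have "j < k - 1"
        proof (rule ccontr)
          assume "\<not> j < k - 1"
          then have "xs ! (k - 1) \<le> xs ! j" using j xs by (intro sorted_nth_mono) auto
          then show False using less j by auto
        qed
        then show "j \<in> {..<k - 1}" by simp
      qed
      then have "card {j. j < m \<and> xs ! j \<le> c} \<le> card {..<k - 1}" by (intro card_mono) auto
      then show False using le card assms by auto
    qed
  qed
qed

lemma ordered_pvalue_in_range:
  assumes "k \<in> {1..m}" "\<And>i. i \<in> {1..m} \<Longrightarrow> q i \<in> {0..1}"
  shows "ordered_pvalue m q k \<in> {0..1}"
proof -
  have "ordered_pvalue m q k \<in> set (sort (map q [1..<Suc m]))"
    unfolding ordered_pvalue_def using assms(1) by (intro nth_mem) (simp, linarith)
  then show ?thesis using assms(2) by auto
qed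

text \<open>At least \<open>k\<close> hypotheses are rejected, with more in case of ties, so the
  denominator may be replaced by \<open>k\<close>; the numerator is the null count at the
  \<open>k\<close>-th p-value.\<close>

lemma FDP_le:
  assumes "k \<in> {1..m}" "H0 \<subseteq> {1..m}"
    and "num_below H0 q (ordered_pvalue m q k) \<le> real k * B"
  shows "FDP H0 (rejection_set m q k) \<le> min 1 B"
proof -
  let ?R = "rejection_set m q k"
  have k: "k \<le> card ?R"
    using ordered_pvalue_le_iff[OF assms(1), of q "ordered_pvalue m q k"] by (simp add: rejection_set_def)
  have fin: "finite ?R" by (simp add: rejection_set_def)
  have k0: "0 < k" using assms by simp
  then have max: "max (card ?R) 1 = card ?R" using k by simp
  have "card (?R \<inter> H0) \<le> card ?R" using fin by (intro card_mono) auto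
  then have 1: "FDP H0 ?R \<le> 1" unfolding FDP_def max using k k0 by simp
  have eq: "?R \<inter> H0 = {i \<in> H0. q i \<le> ordered_pvalue m q k}"
    using assms(2) by (auto simp: rejection_set_def)
  have "FDP H0 ?R \<le> real (card (?R \<inter> H0)) / real k"
    unfolding FDP_def max using k k0 by (intro divide_left_mono) auto
  also have "\<dots> = num_below H0 q (ordered_pvalue m q k) / real k"
    unfolding eq num_below_def ..
  also have "\<dots> \<le> B" using assms(3) k0 by (simp add: field_simps)
  finally show ?thesis using 1 by simp
qed

lemma card_le_num_below_plus_num_above:
  assumes "H0 \<subseteq> {1..m}"
  shows "real (card H0) \<le> num_below H0 q t + real (num_above m q t)"
proof -
  have fin: "finite H0" using assms finite_subset by blast
  have "card H0 \<le> card ({i \<in> H0. q i \<le> t} \<union> {i \<in> {1..m}. q i > t})"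
    using fin assms by (intro card_mono) auto
  also have "\<dots> \<le> card {i \<in> H0. q i \<le> t} + card {i \<in> {1..m}. q i > t}" by (rule card_Un_le)
  finally show ?thesis unfolding num_below_def num_above_def by simp
qed

text \<open>Final step of completing a square in \<open>sqrt m0\<close>; it explains the squared
  shape of the DKW and Wellner estimators.\<close>

lemma le_power2_sqrt:
  assumes "(sqrt x - b)\<^sup>2 \<le> S" "0 \<le> x" "0 \<le> b"
  shows "x \<le> (b + sqrt S)\<^sup>2"
proof -
  have "sqrt x - b \<le> sqrt S" using assms(1) by (rule real_le_rsqrt)
  then have "(sqrt x)\<^sup>2 \<le> (b + sqrt S)\<^sup>2" using assms by (intro power_mono) auto
  then show ?thesis using assms by simp
qed

lemma C_KR_pos:
  assumes "0 < \<delta>" "\<delta> < 1"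
  shows "0 < C_KR \<delta>"
proof -
  have "0 < ln (1 / \<delta>)" using assms by simp
  then show ?thesis unfolding C_KR_def by (intro divide_pos_pos) simp_all
qed

text \<open>Equivalent to the explicit estimate \<open>h_inv y <= (1 + sqrt (y / 2))^2\<close> for
  \<open>y > 0\<close>. The difference of the two sides vanishes at 0 and has derivative
  \<open>4 * ((1 + v) * ln (1 + v) - v)\<close>.\<close>

lemma h_fun_lower_bound:
  assumes "0 \<le> v" shows "2 * v\<^sup>2 \<le> h_fun ((1 + v)\<^sup>2)"
proof -
  define G where "G v = h_fun ((1 + v)\<^sup>2) - 2 * v\<^sup>2" for v
  have "G 0 \<le> G v"
  proof (rule DERIV_nonneg_imp_nondecreasing[OF assms])
    fix x :: real assume x: "0 \<le> x"
    have "(h_fun has_real_derivative ln ((1 + x)\<^sup>2)) (at ((1 + x)\<^sup>2))"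
      using x by (intro h_fun_deriv) simp
    then have "((\<lambda>x. h_fun ((1 + x)\<^sup>2)) has_real_derivative ln ((1 + x)\<^sup>2) * (2 * (1 + x))) (at x)"
      by (rule DERIV_chain2) (auto intro!: derivative_eq_intros)
    then have "(G has_real_derivative ln ((1 + x)\<^sup>2) * (2 * (1 + x)) - 4 * x) (at x)"
      unfolding G_def by (auto intro!: derivative_eq_intros)
    moreover have "ln ((1 + x)\<^sup>2) * (2 * (1 + x)) - 4 * x \<ge> 0"
    proof -
      have "1 - 1 / (1 + x) \<le> ln (1 + x)" using ln_le_minus_one[of "1 / (1 + x)"] x by (simp add: ln_div)
      then have "(1 - 1 / (1 + x)) * (1 + x) \<le> ln (1 + x) * (1 + x)" using x by (intro mult_right_mono) auto
      moreover have "(1 - 1 / (1 + x)) * (1 + x) = x" using x by (simp add: left_diff_distrib)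
      ultimately have "x \<le> ln (1 + x) * (1 + x)" by simp
      then show ?thesis using x by (simp add: ln_realpow algebra_simps)
    qed
    ultimately show "\<exists>d. (G has_real_derivative d) (at x) \<and> 0 \<le> d" by blast
  qed
  then show ?thesis by (simp add: G_def)
qed

text \<open>\<open>x * h_fun (N / x) = N * ln (N / x) - N + x\<close> has derivative
  \<open>1 - N / x\<close> in \<open>x\<close>. This allows the true number of nulls to be replaced
  by a larger estimate.\<close>

lemma h_fun_scaled_antimono:
  assumes "0 < y" "y \<le> x" "x \<le> N"
  shows "x * h_fun (N / x) \<le> y * h_fun (N / y)"
proof -
  have "1 - y / x \<le> ln (x / y)" using ln_le_minus_one[of "y / x"] assms by (simp add: ln_div)
  then have "N * (1 - y / x) \<le> N * ln (x / y)" using assms by (intro mult_left_mono) auto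
  moreover have "x * (1 - y / x) \<le> N * (1 - y / x)" using assms by (intro mult_right_mono) auto
  ultimately have "x - y \<le> N * ln (x / y)" using assms by (simp add: algebra_simps)
  then show ?thesis using assms unfolding h_fun_def by (simp add: ln_div algebra_simps)
qed

lemma C_Well_pos:
  assumes "0 < \<delta>" "\<delta> < 1" "0 < t" "t \<le> 1"
  shows "0 < C_Well \<delta> t"
proof -
  have "0 < ln (kappa / \<delta>)" using kappa_gt_1 assms by simp
  moreover have "0 \<le> log 2 (1 / t)" using assms by simp
  ultimately show ?thesis unfolding C_Well_def by (intro add_pos_nonneg) auto
qed

lemma le_of_scaled_h_fun_le:
  assumes C: "0 < C" and x: "0 < x" and h: "x < N \<Longrightarrow> x * h_fun (N / x) \<le> C"
  shows "N \<le> x + sqrt (2 * x * C) + C / 2"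
proof (rule ccontr)
  assume less: "\<not> ?thesis"
  \<comment> \<open>Makes \<open>x * (1 + v)^2\<close> equal to the claimed upper bound, while the
    preceding estimate gives \<open>x * h_fun ((1 + v)^2) >= C\<close>.\<close>
  define v where "v = sqrt (C / (2 * x))"
  have v: "0 \<le> v" "v\<^sup>2 = C / (2 * x)" using C x by (auto simp: v_def)
  have "2 * x * v = sqrt ((2 * x)\<^sup>2 * (C / (2 * x)))" unfolding v_def real_sqrt_mult real_sqrt_abs using x by simp
  also have "(2 * x)\<^sup>2 * (C / (2 * x)) = 2 * x * C" using x by (simp add: power2_eq_square)
  finally have "x * (1 + v)\<^sup>2 = x + sqrt (2 * x * C) + x * v\<^sup>2"
    by (simp add: power2_eq_square algebra_simps)
  then have eq: "x * (1 + v)\<^sup>2 = x + sqrt (2 * x * C) + C / 2" using x by (simp add: v)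
  then have less': "(1 + v)\<^sup>2 < N / x" using less x by (simp add: pos_less_divide_eq mult.commute)
  have ge1: "1 \<le> (1 + v)\<^sup>2" using v by simp
  then have "x < N" using less' x by (smt (verit) less_divide_eq_1_pos)
  have "C / x = 2 * v\<^sup>2" using x by (simp add: v)
  also have "\<dots> \<le> h_fun ((1 + v)\<^sup>2)" by (rule h_fun_lower_bound[OF v(1)])
  also have "\<dots> < h_fun (N / x)" by (rule h_fun_strict_mono[OF ge1 less'])
  finally have "C < x * h_fun (N / x)" using x by (simp add: field_simps)
  then show False using h[OF \<open>x < N\<close>] by simp
qed

section \<open>Deterministic consequences for one fixed realization\<close>

locale true_nulls =
  fixes m :: nat and H0 :: "nat set" and q :: "nat \<Rightarrow> real" and \<delta> :: real
  assumes H0: "H0 \<subseteq> {1..m}" and H0_pos: "0 < card H0"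
    and q: "\<And>i. i \<in> {1..m} \<Longrightarrow> q i \<in> {0..1}" and delta: "0 < \<delta>" "\<delta> < 1"
begin

abbreviation "m0 \<equiv> real (card H0)"

lemma m0_le: "m0 \<le> real m"
  using card_mono[OF _ H0] by simp

lemma num_above_ge: "m0 - num_below H0 q t \<le> real (num_above m q t)"
  using card_le_num_below_plus_num_above[OF H0, of q t] by simp

lemma ord_nonneg: "k \<in> {1..m} \<Longrightarrow> 0 \<le> ordered_pvalue m q k \<and> ordered_pvalue m q k \<le> 1"
  using ordered_pvalue_in_range[of k m q] q by auto

lemma FDP_bound_Simes:
  assumes N: "\<And>t. 0 \<le> t \<Longrightarrow> num_below H0 q t \<le> m0 * t / \<delta>" and k: "k \<in> {1..m}"
  shows "FDP H0 (rejection_set m q k) \<le> FDP_bound_Simes m \<delta> q k"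
proof -
  have "m0 \<le> (INF t\<in>{0<..<\<delta>}. real (num_above m q t) / (1 - t / \<delta>))"
  proof (rule cINF_greatest)
    fix t assume t: "t \<in> {0<..<\<delta>}"
    then have "m0 * (1 - t / \<delta>) \<le> real (num_above m q t)"
      using num_above_ge[of t] N[of t] by (simp add: algebra_simps)
    moreover have "0 < 1 - t / \<delta>" using t delta by simp
    ultimately show "m0 \<le> real (num_above m q t) / (1 - t / \<delta>)" by (simp add: pos_le_divide_eq)
  qed (use delta in auto)
  then have m0: "m0 \<le> m0_Simes m \<delta> q" using m0_le by (simp add: m0_Simes_def)
  let ?p = "ordered_pvalue m q k"
  have "num_below H0 q ?p \<le> m0 * ?p / \<delta>" using N ord_nonneg[OF k] by simp
  also have "\<dots> \<le> m0_Simes m \<delta> q * ?p / \<delta>"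
    using m0 ord_nonneg[OF k] delta by (intro divide_right_mono mult_right_mono) auto
  also have "\<dots> = real k * (m0_Simes m \<delta> q * ?p / (real k * \<delta>))" using k by simp
  finally show ?thesis unfolding FDP_bound_Simes_def by (rule FDP_le[OF k H0])
qed

lemma FDP_bound_DKW:
  assumes N: "\<And>t. 0 \<le> t \<Longrightarrow> num_below H0 q t \<le> m0 * t + sqrt (m0 * (ln (1 / \<delta>) / 2))" and k: "k \<in> {1..m}"
  shows "FDP H0 (rejection_set m q k) \<le> FDP_bound_DKW m \<delta> q k"
proof -
  define C where "C = C_DKW \<delta>"
  have C: "0 < C" "C = ln (1 / \<delta>) / 2" using delta by (auto simp: C_def C_DKW_def)
  have "m0 \<le> (INF t\<in>{0<..<1}.
       (sqrt C / (2 * (1 - t)) + sqrt (C / (4 * (1 - t)\<^sup>2) + real (num_above m q t) / (1 - t)))\<^sup>2)"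
  proof (rule cINF_greatest)
    fix t :: real assume t: "t \<in> {0<..<1}"
    define d where "d = 1 - t"
    have d: "0 < d" using t by (simp add: d_def)
    have V: "m0 * d - sqrt m0 * sqrt C \<le> real (num_above m q t)"
      using num_above_ge[of t] N[of t] t unfolding C(2)[symmetric] real_sqrt_mult
      by (simp add: d_def algebra_simps)
    \<comment> \<open>The count inequality is quadratic in \<open>sqrt m0\<close>; dividing by
      \<open>d\<close> and completing the square brings it into the form of the estimator.\<close>
    have "(sqrt m0 - sqrt C / (2 * d))\<^sup>2 = (m0 * d - sqrt m0 * sqrt C) / d + C / (4 * d\<^sup>2)"
      using d C by (simp add: power2_diff power_divide power_mult_distrib) (simp add: field_simps)
    also have "\<dots> \<le> C / (4 * d\<^sup>2) + real (num_above m q t) / d"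
      using V d by (simp add: divide_right_mono)
    finally show "m0 \<le> (sqrt C / (2 * (1 - t)) + sqrt (C / (4 * (1 - t)\<^sup>2) + real (num_above m q t) / (1 - t)))\<^sup>2"
      unfolding d_def[symmetric] using d C(1) by (intro le_power2_sqrt) auto
  qed auto
  then have m0: "m0 \<le> m0_DKW m \<delta> q" using m0_le by (simp add: m0_DKW_def C_def)
  let ?p = "ordered_pvalue m q k"
  have "num_below H0 q ?p \<le> m0 * ?p + sqrt m0 * sqrt C"
    using N[of ?p] ord_nonneg[OF k] unfolding C(2)[symmetric] real_sqrt_mult by simp
  also have "\<dots> \<le> m0_DKW m \<delta> q * ?p + sqrt (m0_DKW m \<delta> q) * sqrt C"
    using m0 ord_nonneg[OF k] C by (intro add_mono mult_right_mono) auto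
  also have "\<dots> = real k * (m0_DKW m \<delta> q * ?p / real k + sqrt (m0_DKW m \<delta> q) * sqrt (1 / 2 * ln (1 / \<delta>)) / real k)"
    using k by (simp add: C(2) field_simps)
  finally show ?thesis unfolding FDP_bound_DKW_def by (rule FDP_le[OF k H0])
qed

lemma FDP_bound_KR:
  assumes N: "\<And>t. 0 \<le> t \<Longrightarrow> num_below H0 q t \<le> C_KR \<delta> * (1 + m0 * t)" and k: "k \<in> {1..m}"
  shows "FDP H0 (rejection_set m q k) \<le> FDP_bound_KR m \<delta> q k"
proof -
  have "m0 \<le> (INF t\<in>{0<..<1 / C_KR \<delta>}. (C_KR \<delta> + real (num_above m q t)) / (1 - C_KR \<delta> * t))"
  proof (rule cINF_greatest)
    fix t assume t: "t \<in> {0<..<1 / C_KR \<delta>}"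
    then have "m0 * (1 - C_KR \<delta> * t) \<le> C_KR \<delta> + real (num_above m q t)"
      using num_above_ge[of t] N[of t] by (simp add: algebra_simps)
    moreover have "0 < 1 - C_KR \<delta> * t" using t C_KR_pos[OF delta] by (simp add: field_simps)
    ultimately show "m0 \<le> (C_KR \<delta> + real (num_above m q t)) / (1 - C_KR \<delta> * t)" by (simp add: pos_le_divide_eq)
  qed (use C_KR_pos[OF delta] in auto)
  then have m0: "m0 \<le> m0_KR m \<delta> q" using m0_le by (simp add: m0_KR_def)
  let ?p = "ordered_pvalue m q k"
  have "num_below H0 q ?p \<le> C_KR \<delta> * (1 + m0 * ?p)" using N ord_nonneg[OF k] by simp
  also have "\<dots> \<le> C_KR \<delta> * (1 + m0_KR m \<delta> q * ?p)"
    using m0 ord_nonneg[OF k] C_KR_pos[OF delta] by (intro mult_left_mono add_mono mult_right_mono) auto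
  also have "\<dots> = real k * (C_KR \<delta> * (m0_KR m \<delta> q * ?p / real k + 1 / real k))" using k by (simp add: field_simps)
  finally show ?thesis unfolding FDP_bound_KR_def C_KR_def[symmetric] by (rule FDP_le[OF k H0])
qed

lemma FDP_bound_Well:
  assumes N0: "\<And>t. t \<le> 0 \<Longrightarrow> num_below H0 q t = 0"
    and N: "\<And>t. 0 < t \<Longrightarrow> t \<le> 1 \<Longrightarrow> m0 * t < num_below H0 q t \<Longrightarrow>
        m0 * t * h_fun (num_below H0 q t / (m0 * t)) \<le> C_Well \<delta> t"
    and k: "k \<in> {1..m}"
  shows "FDP H0 (rejection_set m q k) \<le> FDP_bound_Well m \<delta> q k"
proof -
  let ?C = "C_Well \<delta>"
  have "m0 \<le> (INF t\<in>{0<..<1}.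
       (sqrt (t * ?C t / (2 * (1 - t)\<^sup>2))
        + sqrt (?C t / (2 * (1 - t)\<^sup>2) + real (num_above m q t) / (1 - t)))\<^sup>2)"
  proof (rule cINF_greatest)
    fix t :: real assume t: "t \<in> {0<..<1}"
    define d where "d = 1 - t"
    have d: "0 < d" using t by (simp add: d_def)
    have C: "0 < ?C t" using t delta by (intro C_Well_pos) auto
    \<comment> \<open>Half the coefficient of \<open>sqrt m0\<close> in the count inequality after
      division by \<open>d\<close>.\<close>
    define b where "b = sqrt (t * ?C t / (2 * d\<^sup>2))"
    have b: "0 \<le> b" "b\<^sup>2 = t * ?C t / (2 * d\<^sup>2)" using t d C by (auto simp: b_def)
    have "num_below H0 q t \<le> m0 * t + sqrt (2 * (m0 * t) * ?C t) + ?C t / 2"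
      by (rule le_of_scaled_h_fun_le) (use C t H0_pos N in auto)
    also have "sqrt (2 * (m0 * t) * ?C t) = 2 * d * b * sqrt m0"
    proof -
      have "2 * d * b = sqrt ((2 * d)\<^sup>2 * (t * ?C t / (2 * d\<^sup>2)))"
        unfolding b_def real_sqrt_mult real_sqrt_abs using d by simp
      also have "(2 * d)\<^sup>2 * (t * ?C t / (2 * d\<^sup>2)) = 2 * t * ?C t"
        using d by (simp add: power_mult_distrib)
      finally have "2 * d * b * sqrt m0 = sqrt (2 * t * ?C t) * sqrt m0" by simp
      then show ?thesis by (simp add: real_sqrt_mult[symmetric] mult_ac)
    qed
    finally have "m0 * d - 2 * d * b * sqrt m0 - ?C t / 2 \<le> real (num_above m q t)"
      using num_above_ge[of t] by (simp add: d_def algebra_simps)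
    then have V: "(m0 * d - 2 * d * b * sqrt m0 - ?C t / 2) / d \<le> real (num_above m q t) / d"
      using d by (intro divide_right_mono) auto
    have "(sqrt m0 - b)\<^sup>2 = m0 - 2 * b * sqrt m0 + t * ?C t / (2 * d\<^sup>2)"
      by (simp add: power2_diff b(2))
    \<comment> \<open>Since \<open>t = 1 - d\<close>, the square of \<open>b\<close> absorbs the
      additive term \<open>C / 2\<close> of the count bound.\<close>
    also have "t * ?C t / (2 * d\<^sup>2) = ?C t / (2 * d\<^sup>2) - ?C t / (2 * d)"
    proof -
      have "?C t * d + t * ?C t = ?C t" by (simp add: d_def algebra_simps)
      then show ?thesis using d by (simp add: field_simps power2_eq_square)
    qed
    also have "m0 - 2 * b * sqrt m0 + (?C t / (2 * d\<^sup>2) - ?C t / (2 * d))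
        = ?C t / (2 * d\<^sup>2) + (m0 * d - 2 * d * b * sqrt m0 - ?C t / 2) / d"
      using d by (simp add: diff_divide_distrib)
    also have "\<dots> \<le> ?C t / (2 * d\<^sup>2) + real (num_above m q t) / d" using V by simp
    finally show "m0 \<le> (sqrt (t * ?C t / (2 * (1 - t)\<^sup>2))
        + sqrt (?C t / (2 * (1 - t)\<^sup>2) + real (num_above m q t) / (1 - t)))\<^sup>2"
      unfolding d_def[symmetric] b_def[symmetric] using b by (intro le_power2_sqrt) auto
  qed auto
  then have m0: "m0 \<le> m0_Well m \<delta> q" using m0_le by (simp add: m0_Well_def)
  let ?p = "ordered_pvalue m q k"
  have p: "0 \<le> ?p" "?p \<le> 1" using ord_nonneg[OF k] by auto
  show ?thesis
  proof (cases "?p = 0")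
    case True
    have "num_below H0 q ?p \<le> real k * 0" using N0 True by simp
    then show ?thesis unfolding FDP_bound_Well_def if_P[OF True] by (rule FDP_le[OF k H0])
  next
    case False
    then have p0: "0 < ?p" using p by simp
    define x where "x = m0_Well m \<delta> q * ?p"
    have y: "0 < m0 * ?p" "m0 * ?p \<le> x" using p0 m0 H0_pos by (auto simp: x_def)
    have x: "0 < x" using y by simp
    have C: "0 < ?C ?p" using C_Well_pos[OF delta p0 p(2)] .
    define l where "l = h_inv (?C ?p / x)"
    have l: "1 < l" "h_fun l = ?C ?p / x" using h_inv_correct[of "?C ?p / x"] C x by (auto simp: l_def)
    have "num_below H0 q ?p \<le> x * l"
    proof (rule ccontr)
      assume less: "\<not> ?thesis"
      have "x * 1 \<le> x * l" using l x by (intro mult_left_mono) auto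
      then have xN: "x < num_below H0 q ?p" using less by simp
      have "l < num_below H0 q ?p / x" using less x by (simp add: pos_less_divide_eq mult.commute)
      then have "h_fun l < h_fun (num_below H0 q ?p / x)" using l by (intro h_fun_strict_mono) auto
      then have "?C ?p < x * h_fun (num_below H0 q ?p / x)" using x by (simp add: l pos_divide_less_eq mult.commute)
      \<comment> \<open>The entropy bound is known for the true \<open>m0\<close>; as
        \<open>m0 * ?p <= x\<close>, it transfers to the estimate.\<close>
      also have "\<dots> \<le> m0 * ?p * h_fun (num_below H0 q ?p / (m0 * ?p))"
        by (rule h_fun_scaled_antimono) (use y xN in auto)
      also have "\<dots> \<le> ?C ?p" using y xN by (intro N p0 p) auto
      finally show False by simp
    qed
    also have "x * l = real k * (x / real k * l)" using k by simp
    finally have "FDP H0 (rejection_set m q k) \<le> min 1 (x / real k * l)" by (rule FDP_le[OF k H0])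
    then show ?thesis
      unfolding FDP_bound_Well_def if_not_P[OF False] x_def l_def C_Well_def .
  qed
qed

end

section \<open>Measurability\<close>

text \<open>The strict inequality in \<open>num_above\<close> is decisive: \<open>q i > t\<close>
  survives a small increase of \<open>t\<close>, and \<open>q i <= t\<close> survives any
  increase.\<close>

lemma eventually_num_above_eq:
  "eventually (\<lambda>s. num_above m q s = num_above m q t) (at_right t)"
proof -
  have "eventually (\<lambda>s. (q i > s) = (q i > t)) (at_right t)" for i
  proof (cases "q i > t")
    case True
    then show ?thesis unfolding eventually_at_right_field by (intro exI[of _ "q i"]) auto
  next
    case False
    then show ?thesis unfolding eventually_at_right_field by (intro exI[of _ "t + 1"]) auto
  qed
  then have "eventually (\<lambda>s. \<forall>i\<in>{1..m}. (q i > s) = (q i > t)) (at_right t)"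
    by (intro eventually_ball_finite) auto
  then show ?thesis
  proof (rule eventually_mono)
    fix s assume "\<forall>i\<in>{1..m}. (q i > s) = (q i > t)"
    then have "{i \<in> {1..m}. q i > s} = {i \<in> {1..m}. q i > t}" by blast
    then show "num_above m q s = num_above m q t" by (simp add: num_above_def)
  qed
qed

text \<open>Rational \<open>t\<close> suffice because \<^const>\<open>num_above\<close> is right continuous in \<open>t\<close>.\<close>

lemma INF_num_above_rat:
  fixes f :: "real \<Rightarrow> nat \<Rightarrow> real"
  assumes "a < b" and cont: "\<And>v. continuous_on {a<..<b} (\<lambda>t. f t v)"
    and nonneg: "\<And>t v. t \<in> {a<..<b} \<Longrightarrow> 0 \<le> f t v"
  shows "(INF t\<in>{a<..<b}. f t (num_above m q t)) = (INF t\<in>{a<..<b} \<inter> \<rat>. f t (num_above m q t))"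
proof (rule antisym)
  have ne: "{a<..<b} \<inter> \<rat> \<noteq> {}" using Rats_dense_in_real[OF assms(1)] by auto
  have bdd: "bdd_below ((\<lambda>t. f t (num_above m q t)) ` {a<..<b})"
    using nonneg by (intro bdd_belowI2[of _ 0]) auto
  show "(INF t\<in>{a<..<b}. f t (num_above m q t)) \<le> (INF t\<in>{a<..<b} \<inter> \<rat>. f t (num_above m q t))"
    by (rule cINF_superset_mono[OF ne bdd]) auto
  have bdd': "bdd_below ((\<lambda>t. f t (num_above m q t)) ` ({a<..<b} \<inter> \<rat>))"
    by (rule bdd_below_mono[OF bdd]) auto
  show "(INF t\<in>{a<..<b} \<inter> \<rat>. f t (num_above m q t)) \<le> (INF t\<in>{a<..<b}. f t (num_above m q t))"
  proof (rule cINF_greatest)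
    fix t assume t: "t \<in> {a<..<b}"
    let ?c = "INF t\<in>{a<..<b} \<inter> \<rat>. f t (num_above m q t)"
    let ?v = "num_above m q t"
    show "?c \<le> f t ?v"
    proof (rule ccontr)
      assume less: "\<not> ?c \<le> f t ?v"
      have "isCont (\<lambda>t. f t ?v) t"
        using cont t by (simp add: continuous_on_eq_continuous_at)
      then have "((\<lambda>t. f t ?v) \<longlongrightarrow> f t ?v) (at_right t)"
        unfolding isCont_def by (rule filterlim_mono) (simp_all add: at_le)
      then have "eventually (\<lambda>s. f s ?v < ?c) (at_right t)"
        by (rule order_tendstoD(2)) (use less in simp)
      moreover have "eventually (\<lambda>s. s \<in> {t<..<b}) (at_right t)"
        by (rule eventually_at_right_real) (use t in auto)
      ultimately have "eventually (\<lambda>s. f s ?v < ?c \<and> s \<in> {t<..<b} \<and> num_above m q s = ?v) (at_right t)"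
        using eventually_num_above_eq[of m q t] by eventually_elim auto
      then obtain u where u: "u > t"
        "\<And>s. t < s \<Longrightarrow> s < u \<Longrightarrow> f s ?v < ?c \<and> s \<in> {t<..<b} \<and> num_above m q s = ?v"
        unfolding eventually_at_right_field by blast
      obtain r where r: "r \<in> \<rat>" "t < r" "r < u" using Rats_dense_in_real[OF u(1)] by auto
      have "?c \<le> f r (num_above m q r)"
        by (rule cINF_lower[OF bdd']) (use r u(2)[of r] t in auto)
      then show False using u(2)[of r] r by auto
    qed
  qed (use assms(1) in simp)
qed

lemma measurable_card_Collect:
  fixes A :: "nat set"
  assumes "\<And>i. i \<in> A \<Longrightarrow> Measurable.pred M (P i)"
  shows "(\<lambda>\<omega>. card {i \<in> A. P i \<omega>}) \<in> M \<rightarrow>\<^sub>M count_space UNIV"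
proof (rule measurable_card)
  fix i
  show "{\<omega> \<in> space M. i \<in> {i \<in> A. P i \<omega>}} \<in> sets M"
    using assms[of i] by (cases "i \<in> A") (auto simp: pred_def)
qed

lemma borel_measurable_INF_num_above:
  fixes f :: "real \<Rightarrow> nat \<Rightarrow> real" and p :: "nat \<Rightarrow> 'a \<Rightarrow> real"
  assumes p: "\<And>i. i \<in> {1..m} \<Longrightarrow> p i \<in> borel_measurable M"
    and "a < b" and "\<And>v. continuous_on {a<..<b} (\<lambda>t. f t v)"
    and "\<And>t v. t \<in> {a<..<b} \<Longrightarrow> 0 \<le> f t v"
  shows "(\<lambda>\<omega>. INF t\<in>{a<..<b}. f t (num_above m (\<lambda>i. p i \<omega>) t)) \<in> borel_measurable M"
proof -
  have "(\<lambda>\<omega>. num_above m (\<lambda>i. p i \<omega>) t) \<in> M \<rightarrow>\<^sub>M count_space UNIV" for t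
    unfolding num_above_def
  proof (rule measurable_card_Collect)
    fix i assume "i \<in> {1..m}"
    then have [measurable]: "p i \<in> borel_measurable M" by (rule p)
    show "Measurable.pred M (\<lambda>\<omega>. t < p i \<omega>)" by measurable
  qed
  then have "(\<lambda>\<omega>. f t (num_above m (\<lambda>i. p i \<omega>) t)) \<in> borel_measurable M" for t
    by (rule measurable_compose) simp
  moreover have "countable ({a<..<b} \<inter> \<rat>)" by (rule countable_subset[OF Int_lower2 countable_rat])
  ultimately have "(\<lambda>\<omega>. INF t\<in>{a<..<b} \<inter> \<rat>. f t (num_above m (\<lambda>i. p i \<omega>) t)) \<in> borel_measurable M"
    by (intro borel_measurable_cINF_real)
  moreover have "(INF t\<in>{a<..<b}. f t (num_above m (\<lambda>i. p i \<omega>) t)) =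
      (INF t\<in>{a<..<b} \<inter> \<rat>. f t (num_above m (\<lambda>i. p i \<omega>) t))" for \<omega>
    by (rule INF_num_above_rat) (use assms in auto)
  ultimately show ?thesis by (simp only:)
qed

section \<open>Measurability of the bounds and of the events in the conclusion\<close>

context
  fixes M :: "'a measure" and p :: "nat \<Rightarrow> 'a \<Rightarrow> real" and m :: nat
  assumes p: "\<And>i. i \<in> {1..m} \<Longrightarrow> p i \<in> borel_measurable M"
begin

lemma measurable_card_le:
  assumes "A \<subseteq> {1..m}" and [measurable]: "f \<in> borel_measurable M"
  shows "(\<lambda>\<omega>. card {i \<in> A. p i \<omega> \<le> f \<omega>}) \<in> M \<rightarrow>\<^sub>M count_space UNIV"
proof (rule measurable_card_Collect)
  fix i assume "i \<in> A"
  then have [measurable]: "p i \<in> borel_measurable M" using assms(1) p by blast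
  show "Measurable.pred M (\<lambda>\<omega>. p i \<omega> \<le> f \<omega>)" by measurable
qed

lemma borel_measurable_ordered_pvalue:
  assumes "k \<in> {1..m}"
  shows "(\<lambda>\<omega>. ordered_pvalue m (\<lambda>i. p i \<omega>) k) \<in> borel_measurable M"
proof (rule borel_measurableI_le)
  fix y
  have [measurable]: "(\<lambda>\<omega>. card {i \<in> {1..m}. p i \<omega> \<le> y}) \<in> M \<rightarrow>\<^sub>M count_space UNIV"
    by (rule measurable_card_le) auto
  show "{\<omega> \<in> space M. ordered_pvalue m (\<lambda>i. p i \<omega>) k \<le> y} \<in> sets M"
    unfolding ordered_pvalue_le_iff[OF assms] by measurable
qed

lemma borel_measurable_FDP:
  assumes "k \<in> {1..m}"
  shows "(\<lambda>\<omega>. FDP H0 (rejection_set m (\<lambda>i. p i \<omega>) k)) \<in> borel_measurable M"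
proof -
  note [measurable] = borel_measurable_ordered_pvalue[OF assms]
  have eq: "rejection_set m (\<lambda>i. p i \<omega>) k \<inter> H0 =
      {i \<in> {1..m} \<inter> H0. p i \<omega> \<le> ordered_pvalue m (\<lambda>i. p i \<omega>) k}" for \<omega>
    by (auto simp: rejection_set_def)
  have [measurable]:
    "(\<lambda>\<omega>. card {i \<in> {1..m} \<inter> H0. p i \<omega> \<le> ordered_pvalue m (\<lambda>i. p i \<omega>) k}) \<in> M \<rightarrow>\<^sub>M count_space UNIV"
    "(\<lambda>\<omega>. card {i \<in> {1..m}. p i \<omega> \<le> ordered_pvalue m (\<lambda>i. p i \<omega>) k}) \<in> M \<rightarrow>\<^sub>M count_space UNIV"
    by (rule measurable_card_le; simp add: borel_measurable_ordered_pvalue[OF assms])+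
  show ?thesis
    unfolding FDP_def eq unfolding rejection_set_def of_nat_max by measurable
qed

text \<open>Needed for the claim itself, since a non-measurable set is assigned measure 0.\<close>

lemma FDP_event:
  assumes "\<And>k. k \<in> {1..m} \<Longrightarrow> F k \<in> borel_measurable M"
  shows "{\<omega> \<in> space M. \<forall>k\<in>{1..m}. FDP H0 (rejection_set m (\<lambda>i. p i \<omega>) k) \<le> F k \<omega>} \<in> sets M"
proof (rule sets.sets_Collect_finite_All)
  fix k assume "k \<in> {1..m}"
  note [measurable] = borel_measurable_FDP[OF this] assms[OF this]
  show "{\<omega> \<in> space M. FDP H0 (rejection_set m (\<lambda>i. p i \<omega>) k) \<le> F k \<omega>} \<in> sets M" by measurable
qed simp

context
  fixes \<delta> :: real
  assumes delta: "0 < \<delta>" "\<delta> < 1"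
begin

lemma borel_measurable_FDP_bound_Simes:
  assumes "k \<in> {1..m}"
  shows "(\<lambda>\<omega>. FDP_bound_Simes m \<delta> (\<lambda>i. p i \<omega>) k) \<in> borel_measurable M"
proof -
  have [measurable]: "(\<lambda>\<omega>. m0_Simes m \<delta> (\<lambda>i. p i \<omega>)) \<in> borel_measurable M"
    unfolding m0_Simes_def
    by (intro borel_measurable_min borel_measurable_INF_num_above[where f = "\<lambda>t v. real v / (1 - t / \<delta>)"]
      p borel_measurable_const continuous_intros) (use delta in auto)
  note [measurable] = borel_measurable_ordered_pvalue[OF assms]
  show ?thesis unfolding FDP_bound_Simes_def by measurable
qed

lemma borel_measurable_FDP_bound_DKW:
  assumes "k \<in> {1..m}"
  shows "(\<lambda>\<omega>. FDP_bound_DKW m \<delta> (\<lambda>i. p i \<omega>) k) \<in> borel_measurable M"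
proof -
  have [measurable]: "(\<lambda>\<omega>. m0_DKW m \<delta> (\<lambda>i. p i \<omega>)) \<in> borel_measurable M"
    unfolding m0_DKW_def
    by (intro borel_measurable_min borel_measurable_INF_num_above[where
          f = "\<lambda>t v. (sqrt (C_DKW \<delta>) / (2 * (1 - t)) + sqrt (C_DKW \<delta> / (4 * (1 - t)\<^sup>2) + real v / (1 - t)))\<^sup>2"]
      p borel_measurable_const continuous_intros) auto
  note [measurable] = borel_measurable_ordered_pvalue[OF assms]
  show ?thesis unfolding FDP_bound_DKW_def by measurable
qed

lemma borel_measurable_FDP_bound_KR:
  assumes "k \<in> {1..m}"
  shows "(\<lambda>\<omega>. FDP_bound_KR m \<delta> (\<lambda>i. p i \<omega>) k) \<in> borel_measurable M"
proof -
  have C: "0 < C_KR \<delta>" by (rule C_KR_pos[OF delta])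
  then have nz: "C_KR \<delta> * t < 1" if "t < 1 / C_KR \<delta>" for t using that by (simp add: field_simps)
  have nz': "1 - C_KR \<delta> * t \<noteq> 0" if "t \<in> {0<..<1 / C_KR \<delta>}" for t using nz[of t] that by auto
  have [measurable]: "(\<lambda>\<omega>. m0_KR m \<delta> (\<lambda>i. p i \<omega>)) \<in> borel_measurable M"
    unfolding m0_KR_def
    by (intro borel_measurable_min borel_measurable_INF_num_above[where
          f = "\<lambda>t v. (C_KR \<delta> + real v) / (1 - C_KR \<delta> * t)"]
      p borel_measurable_const continuous_intros ballI nz') (use C nz in \<open>auto intro!: divide_nonneg_nonneg less_imp_le\<close>)
  note [measurable] = borel_measurable_ordered_pvalue[OF assms]
  show ?thesis unfolding FDP_bound_KR_def by measurable
qed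

text \<open>\<open>h_inv\<close> has no specified values outside the positive reals. Cut off by 0
  there, it is monotone and hence Borel.\<close>

lemma borel_measurable_h_inv: "(\<lambda>x. if 0 < x then h_inv x else 0) \<in> borel_measurable borel"
proof (rule borel_measurable_mono, rule monoI)
  fix x y :: real assume "x \<le> y"
  show "(if 0 < x then h_inv x else 0) \<le> (if 0 < y then h_inv y else 0)"
  proof (cases "0 < x")
    case True
    have "h_inv x \<le> h_inv y"
    proof (rule ccontr)
      assume "\<not> ?thesis"
      then have "h_fun (h_inv y) < h_fun (h_inv x)"
        using h_inv_correct[of y] True \<open>x \<le> y\<close> by (intro h_fun_strict_mono) auto
      then show False using h_inv_correct[of x] h_inv_correct[of y] True \<open>x \<le> y\<close> by simp
    qed
    then show ?thesis using True \<open>x \<le> y\<close> by simp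
  next
    case False
    then show ?thesis using h_inv_correct[of y] by auto
  qed
qed

lemma borel_measurable_FDP_bound_Well:
  assumes k: "k \<in> {1..m}" and range: "\<And>i \<omega>. i \<in> {1..m} \<Longrightarrow> \<omega> \<in> space M \<Longrightarrow> p i \<omega> \<in> {0..1}"
  shows "(\<lambda>\<omega>. FDP_bound_Well m \<delta> (\<lambda>i. p i \<omega>) k) \<in> borel_measurable M"
proof -
  have log: "log 2 (1 / t) \<ge> 0" if "0 < t" "t < 1" for t :: real using that by simp
  have cont: "continuous_on {0<..<1} (\<lambda>t. log 2 (1 / t))"
    unfolding log_def by (intro continuous_intros) auto
  have contC: "continuous_on {0<..<1} (C_Well \<delta>)"
    unfolding C_Well_def by (intro continuous_intros cont) (use log in \<open>auto simp: add_nonneg_eq_0_iff\<close>)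
  let ?f = "\<lambda>t v. (sqrt (t * C_Well \<delta> t / (2 * (1 - t)\<^sup>2))
        + sqrt (C_Well \<delta> t / (2 * (1 - t)\<^sup>2) + real v / (1 - t)))\<^sup>2"
  have [measurable]: "(\<lambda>\<omega>. m0_Well m \<delta> (\<lambda>i. p i \<omega>)) \<in> borel_measurable M"
    unfolding m0_Well_def
    by (intro borel_measurable_min borel_measurable_INF_num_above[where f = ?f]
      p borel_measurable_const continuous_intros contC) auto
  note [measurable] = borel_measurable_ordered_pvalue[OF k] borel_measurable_h_inv
  let ?h = "\<lambda>x. if 0 < x then h_inv x else 0"
  let ?x = "\<lambda>\<omega>. m0_Well m \<delta> (\<lambda>i. p i \<omega>) * ordered_pvalue m (\<lambda>i. p i \<omega>) k"
  let ?C = "\<lambda>\<omega>. C_Well \<delta> (ordered_pvalue m (\<lambda>i. p i \<omega>) k)"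
  have [measurable]: "?C \<in> borel_measurable M" unfolding C_Well_def by measurable
  have "(\<lambda>\<omega>. ?h (?C \<omega> / ?x \<omega>)) \<in> borel_measurable M"
    by (rule measurable_compose[OF _ borel_measurable_h_inv]) measurable
  then have "(\<lambda>\<omega>. min 1 (if ordered_pvalue m (\<lambda>i. p i \<omega>) k = 0 then 0
      else ?x \<omega> / real k * ?h (?C \<omega> / ?x \<omega>))) \<in> borel_measurable M"
    by measurable
  moreover have "FDP_bound_Well m \<delta> (\<lambda>i. p i \<omega>) k = min 1 (if ordered_pvalue m (\<lambda>i. p i \<omega>) k = 0 then 0
      else ?x \<omega> / real k * ?h (?C \<omega> / ?x \<omega>))" if "\<omega> \<in> space M" for \<omega>
  proof (cases "ordered_pvalue m (\<lambda>i. p i \<omega>) k = 0")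
    case False
    have ord: "ordered_pvalue m (\<lambda>i. p i \<omega>) k \<in> {0..1}"
      by (rule ordered_pvalue_in_range[OF k]) (use range that in auto)
    have C: "0 < ?C \<omega>" by (rule C_Well_pos[OF delta]) (use ord False in auto)
    have "0 \<le> (INF t\<in>{0<..<1}. ?f t (num_above m (\<lambda>i. p i \<omega>) t))"
      by (rule cINF_greatest) auto
    then have "0 \<le> m0_Well m \<delta> (\<lambda>i. p i \<omega>)" unfolding m0_Well_def by simp
    then have x: "0 \<le> ?x \<omega>" using ord by auto
    \<comment> \<open>The cut-off changes the argument of \<open>h_inv\<close> only where
      \<open>?x\<close> is 0, and there the prefactor is 0 as well.\<close>
    have "?x \<omega> / real k * h_inv (?C \<omega> / ?x \<omega>) = ?x \<omega> / real k * ?h (?C \<omega> / ?x \<omega>)"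
    proof (cases "?x \<omega> = 0")
      case False
      have "0 < ?x \<omega>" by (rule order.not_eq_order_implies_strict[OF not_sym[OF False] x])
      then have "0 < ?C \<omega> / ?x \<omega>" using C by (rule divide_pos_pos[rotated])
      then show ?thesis by simp
    qed simp
    then show ?thesis
      unfolding FDP_bound_Well_def if_not_P[OF False] C_Well_def[symmetric] by (rule arg_cong)
  qed (simp add: FDP_bound_Well_def)
  ultimately show ?thesis by (simp cong: measurable_cong)
qed

end

end

lemma (in prob_space) prob_ge_of_compl_subset:
  assumes "B \<in> events" "prob B \<le> \<delta>" "A \<in> events" "space M - B \<subseteq> A"
  shows "1 - \<delta> \<le> prob A"
proof -
  have "1 - \<delta> \<le> prob (space M - B)" using assms(1,2) by (simp add: prob_compl)
  also have "\<dots> \<le> prob A" using assms by (intro finite_measure_mono) auto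
  finally show ?thesis .
qed

theorem proposition14:
  fixes M :: "'a measure" and p :: "nat \<Rightarrow> 'a \<Rightarrow> real"
    and m :: nat and H0 :: "nat set" and \<delta> :: real
  assumes "prob_space M"
    and "prob_space.indep_vars M (\<lambda>_. borel) p {1..m}"
    and "\<And>i \<omega>. i \<in> {1..m} \<Longrightarrow> \<omega> \<in> space M \<Longrightarrow> p i \<omega> \<in> {0..1}"
    and "H0 \<subseteq> {1..m}" and "0 < card H0" and "card H0 < m"
    and "\<And>i. i \<in> H0 \<Longrightarrow> distr M borel (p i) = uniform_measure lborel {0..1}"
    and "0 < \<delta>" and "\<delta> < 1"
  shows
    "\<P>(\<omega> in M. \<forall>k\<in>{1..m}.
        FDP H0 (rejection_set m (\<lambda>i. p i \<omega>) k) \<le> FDP_bound_Simes m \<delta> (\<lambda>i. p i \<omega>) k) \<ge> 1 - \<delta>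
     \<and> \<P>(\<omega> in M. \<forall>k\<in>{1..m}.
        FDP H0 (rejection_set m (\<lambda>i. p i \<omega>) k) \<le> FDP_bound_DKW m \<delta> (\<lambda>i. p i \<omega>) k) \<ge> 1 - \<delta>
     \<and> (\<delta> \<le> 31 / 100 \<longrightarrow> \<P>(\<omega> in M. \<forall>k\<in>{1..m}.
        FDP H0 (rejection_set m (\<lambda>i. p i \<omega>) k) \<le> FDP_bound_KR m \<delta> (\<lambda>i. p i \<omega>) k) \<ge> 1 - \<delta>)
     \<and> \<P>(\<omega> in M. \<forall>k\<in>{1..m}.
        FDP H0 (rejection_set m (\<lambda>i. p i \<omega>) k) \<le> FDP_bound_Well m \<delta> (\<lambda>i. p i \<omega>) k) \<ge> 1 - \<delta>"
proof -
  interpret prob_space M by fact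
  note delta = \<open>0 < \<delta>\<close> \<open>\<delta> < 1\<close>
  have p: "p i \<in> borel_measurable M" if "i \<in> {1..m}" for i
    using assms(2) that by (auto simp: indep_vars_def)
  interpret uniform_sample M p H0
  proof
    show "finite H0" "H0 \<noteq> {}" using assms(5) by (auto simp: card_gt_0_iff)
    show "indep_vars (\<lambda>_. borel) p H0" using assms(2,4) by (rule indep_vars_subset)
  qed (use assms in auto)
  have nulls: "true_nulls m H0 (\<lambda>i. p i \<omega>) \<delta>" if "\<omega> \<in> space M" for \<omega>
    by unfold_locales (use assms that in auto)
  have "1 - \<delta> \<le> \<P>(\<omega> in M. \<forall>k\<in>{1..m}.
        FDP H0 (rejection_set m (\<lambda>i. p i \<omega>) k) \<le> FDP_bound_Simes m \<delta> (\<lambda>i. p i \<omega>) k)"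
  proof -
    obtain B where B: "B \<in> events" "prob B \<le> \<delta>"
      "\<And>\<omega> t. \<omega> \<in> space M - B \<Longrightarrow> 0 \<le> t \<Longrightarrow> N \<omega> t \<le> n * t / \<delta>"
      using Simes_event[OF delta] by blast
    show ?thesis
      by (rule prob_ge_of_compl_subset[OF B(1,2) FDP_event[OF p borel_measurable_FDP_bound_Simes[OF p delta]]])
        (use true_nulls.FDP_bound_Simes[OF nulls] B(3) in auto)
  qed
  moreover have "1 - \<delta> \<le> \<P>(\<omega> in M. \<forall>k\<in>{1..m}.
        FDP H0 (rejection_set m (\<lambda>i. p i \<omega>) k) \<le> FDP_bound_DKW m \<delta> (\<lambda>i. p i \<omega>) k)"
  proof -
    obtain B where B: "B \<in> events" "prob B \<le> \<delta>"
      "\<And>\<omega> t. \<omega> \<in> space M - B \<Longrightarrow> 0 \<le> t \<Longrightarrow> N \<omega> t \<le> n * t + sqrt (n * (ln (1 / \<delta>) / 2))"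
      using DKW_event[OF delta] by blast
    show ?thesis
      by (rule prob_ge_of_compl_subset[OF B(1,2) FDP_event[OF p borel_measurable_FDP_bound_DKW[OF p delta]]])
        (use true_nulls.FDP_bound_DKW[OF nulls] B(3) in auto)
  qed
  moreover have "1 - \<delta> \<le> \<P>(\<omega> in M. \<forall>k\<in>{1..m}.
        FDP H0 (rejection_set m (\<lambda>i. p i \<omega>) k) \<le> FDP_bound_KR m \<delta> (\<lambda>i. p i \<omega>) k)"
  proof -
    obtain B where B: "B \<in> events" "prob B \<le> \<delta>"
      "\<And>\<omega> t. \<omega> \<in> space M - B \<Longrightarrow> 0 \<le> t \<Longrightarrow> N \<omega> t \<le> C_KR \<delta> * (1 + n * t)"
      using KR_event[OF delta] by blast
    show ?thesis
      by (rule prob_ge_of_compl_subset[OF B(1,2) FDP_event[OF p borel_measurable_FDP_bound_KR[OF p delta]]])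
        (use true_nulls.FDP_bound_KR[OF nulls] B(3) in auto)
  qed
  moreover have "1 - \<delta> \<le> \<P>(\<omega> in M. \<forall>k\<in>{1..m}.
        FDP H0 (rejection_set m (\<lambda>i. p i \<omega>) k) \<le> FDP_bound_Well m \<delta> (\<lambda>i. p i \<omega>) k)"
  proof -
    obtain B where B: "B \<in> events" "prob B \<le> \<delta>"
      "\<And>\<omega> t. \<omega> \<in> space M - B \<Longrightarrow> t \<le> 0 \<Longrightarrow> N \<omega> t = 0"
      "\<And>\<omega> t. \<omega> \<in> space M - B \<Longrightarrow> 0 < t \<Longrightarrow> t \<le> 1 \<Longrightarrow> n * t < N \<omega> t \<Longrightarrow>
        n * t * h_fun (N \<omega> t / (n * t)) \<le> C_Well \<delta> t"
      using Well_event[OF delta] by blast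
    show ?thesis
      by (rule prob_ge_of_compl_subset[OF B(1,2) FDP_event[OF p borel_measurable_FDP_bound_Well[OF p delta _ assms(3)]]])
        (use true_nulls.FDP_bound_Well[OF nulls] B(3,4) in auto)
  qed
  ultimately show ?thesis by (intro conjI impI)
qed

end
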